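(* Let $X$ and $Y$ be finite cell complexes and let $\xi_X\in H^1(X;\mathbf R)$ and $\xi_Y\in H^1(Y;\mathbf R)$ be real cohomology classes. Assume that $\mathrm{ccat}(X,\xi_X)>0$ or $\mathrm{ccat}(Y,\xi_Y)>0$. Then $$\mathrm{ccat}(X\times Y,\xi)\le\mathrm{ccat}(X,\xi_X)+\mathrm{ccat}(Y,\xi_Y)-1,$$ where $\xi=\xi_X\times1+1\times\xi_Y\in H^1(X\times Y;\mathbf R)$.
   Context: Closed 1-forms. A continuous closed 1-form $\omega$ on a topological space $X$ is given by a family of continuous functions $f_U:U\to\mathbf R$, indexed by the members of an open cover of $X$, such that $f_U-f_V$ is locally constant on $U\cap V$ for all $U,V$; two families define the same closed 1-form if their union is again such a family. For a path $\gamma:[0,1]\to X$ set $\int_\gamma\omega=\sum_i\left(f_{U_i}(\gamma(t_{i+1}))-f_{U_i}(\gamma(t_i))\right)$, where $0=t_0<\dots<t_m=1$ and $\gamma([t_i,t_{i+1}])\subset U_i$. Integration over loops defines the class $[\omega]\in H^1(X;\mathbf R)$ represented by $\omega$; on a finite cell complex every class is represented. Definition of $\mathrm{ccat}(X,\xi)$, for $X$ a finite cell complex and $\xi\in H^1(X;\mathbf R)$. Fix a continuous closed 1-form $\omega$ representing $\xi$. For real numbers $N,C$, a subset $A\subset X$ is $N$-movable with respect to $\omega$ with control $C$ if there is a continuous homotopy $h_t:A\to X$, $t\in[0,1]$, such that (1) $h_0$ is the inclusion; (2) $\int_x^{h_1(x)}\omega<-N$ for every $x\in A$; (3) $\int_x^{h_t(x)}\omega\le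 C$ for every $x\in A$ and $t\in[0,1]$; the integrals are along the path $\tau\mapsto h_\tau(x)$. $\mathrm{ccat}(X,\xi)$ is the minimal integer $k\ge0$ for which there exists $C>0$ such that for every $N>0$ there is an open cover $X=F\cup F_1\cup\dots\cup F_k$ with each inclusion $F_j\to X$ null-homotopic and with $F$ $N$-movable with control $C$ with respect to $\omega$. It does not depend on the choice of $\omega$ in the class $\xi$.
   Formalization: If both ccat(X,ξ_X) and ccat(Y,ξ_Y) are positive, X and Y are additionally assumed connected; without this the claim fails, e.g. for X = Y = two points with zero classes, where ccat(X×Y,ξ) = 4 > 3. *)

theory Defs
  imports "HOL-Homology.Homology" "HOL-Library.Extended_Nat"
begin

definition cell_disc :: "nat \<Rightarrow> (nat \<Rightarrow> real) topology" where
  "cell_disc n = subtopology (Euclidean_space n) {x. (\<Sum>i<n. (x i)\<^sup>2) \<le> 1}"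

definition cell_interior :: "nat \<Rightarrow> (nat \<Rightarrow> real) set" where
  "cell_interior n = {x \<in> topspace (cell_disc n). (\<Sum>i<n. (x i)\<^sup>2) < 1}"

definition cell_boundary :: "nat \<Rightarrow> (nat \<Rightarrow> real) set" where
  "cell_boundary n = {x \<in> topspace (cell_disc n). (\<Sum>i<n. (x i)\<^sup>2) = 1}"

text \<open>
  A finite CW complex, presented by its characteristic maps \<open>\<Phi> i\<close>, \<open>i < m\<close>, from discs of
  dimension \<open>d i\<close>. For finitely many cells the weak topology and closure finiteness are automatic
  in a Hausdorff space, and \<open>\<Phi> i\<close> restricts to a homeomorphism from the open disc onto its cell.
\<close>

definition finite_cell_complex :: "'a topology \<Rightarrow> bool" where
  "finite_cell_complex X \<longleftrightarrow> Hausdorff_space X \<and>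
     (\<exists>(m::nat) (d :: nat \<Rightarrow> nat) (\<Phi> :: nat \<Rightarrow> (nat \<Rightarrow> real) \<Rightarrow> 'a).
        (\<forall>i<m. continuous_map (cell_disc (d i)) X (\<Phi> i) \<and>
               inj_on (\<Phi> i) (cell_interior (d i)) \<and>
               \<Phi> i ` cell_boundary (d i) \<subseteq> (\<Union>j\<in>{j. j < m \<and> d j < d i}. \<Phi> j ` cell_interior (d j))) \<and>
        (\<forall>i<m. \<forall>j<m. i \<noteq> j \<longrightarrow> \<Phi> i ` cell_interior (d i) \<inter> \<Phi> j ` cell_interior (d j) = {}) \<and>
        topspace X = (\<Union>i<m. \<Phi> i ` cell_interior (d i)))"

text \<open>
  A \<open>p\<close>-cochain is a real function on singular \<open>p\<close>-simplices. Only its values on the singular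
  \<open>p\<close>-simplices of the space matter; cochains with the same such values are cohomologous.
\<close>

type_synonym 'a cochain = "((nat \<Rightarrow> real) \<Rightarrow> 'a) \<Rightarrow> real"

definition coboundary :: "nat \<Rightarrow> 'a cochain \<Rightarrow> 'a cochain" where
  "coboundary p \<phi> \<sigma> = (\<Sum>k\<le>Suc p. (-1) ^ k * \<phi> (singular_face (Suc p) k \<sigma>))"

definition cocycles :: "nat \<Rightarrow> 'a topology \<Rightarrow> 'a cochain set" where
  "cocycles p X = {\<phi>. \<forall>\<sigma>. singular_simplex (Suc p) X \<sigma> \<longrightarrow> coboundary p \<phi> \<sigma> = 0}"

definition cohomologous :: "nat \<Rightarrow> 'a topology \<Rightarrow> 'a cochain rel" where
  "cohomologous p X = {(\<phi>, \<psi>). \<phi> \<in> cocycles p X \<and> \<psi> \<in> cocycles p X \<and>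
     (\<exists>\<eta>. \<forall>\<sigma>. singular_simplex p X \<sigma> \<longrightarrow>
        \<phi> \<sigma> - \<psi> \<sigma> = (if p = 0 then 0 else coboundary (p - 1) \<eta> \<sigma>))}"

definition cohomology :: "nat \<Rightarrow> 'a topology \<Rightarrow> 'a cochain set set" where
  "cohomology p X = cocycles p X // cohomologous p X"

definition cohomology_add ::
    "nat \<Rightarrow> 'a topology \<Rightarrow> 'a cochain set \<Rightarrow> 'a cochain set \<Rightarrow> 'a cochain set" where
  "cohomology_add p X a b = (\<Union>\<phi>\<in>a. \<Union>\<psi>\<in>b. cohomologous p X `` {\<lambda>\<sigma>. \<phi> \<sigma> + \<psi> \<sigma>})"

definition cohomology_one :: "'a topology \<Rightarrow> 'a cochain set" where
  "cohomology_one X = cohomologous 0 X `` {\<lambda>_. 1}"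

definition cohomology_pullback ::
    "nat \<Rightarrow> 'a topology \<Rightarrow> ('a \<Rightarrow> 'b) \<Rightarrow> 'b cochain set \<Rightarrow> 'a cochain set" where
  "cohomology_pullback p X f b = (\<Union>\<phi>\<in>b. cohomologous p X `` {\<lambda>\<sigma>. \<phi> (simplex_map p f \<sigma>)})"

definition front_face :: "nat \<Rightarrow> ((nat \<Rightarrow> real) \<Rightarrow> 'a) \<Rightarrow> (nat \<Rightarrow> real) \<Rightarrow> 'a" where
  "front_face p \<sigma> = restrict \<sigma> (standard_simplex p)"

definition back_face :: "nat \<Rightarrow> nat \<Rightarrow> ((nat \<Rightarrow> real) \<Rightarrow> 'a) \<Rightarrow> (nat \<Rightarrow> real) \<Rightarrow> 'a" where
  "back_face p q \<sigma> = restrict (\<lambda>x. \<sigma> (\<lambda>i. if i < p then 0 else x (i - p))) (standard_simplex q)"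

definition cup_cochain :: "nat \<Rightarrow> nat \<Rightarrow> 'a cochain \<Rightarrow> 'a cochain \<Rightarrow> 'a cochain" where
  "cup_cochain p q \<phi> \<psi> \<sigma> = \<phi> (front_face p \<sigma>) * \<psi> (back_face p q \<sigma>)"

definition cup_product ::
    "nat \<Rightarrow> nat \<Rightarrow> 'a topology \<Rightarrow> 'a cochain set \<Rightarrow> 'a cochain set \<Rightarrow> 'a cochain set" where
  "cup_product p q X a b = (\<Union>\<phi>\<in>a. \<Union>\<psi>\<in>b. cohomologous (p + q) X `` {cup_cochain p q \<phi> \<psi>})"

definition cross_product ::
    "nat \<Rightarrow> nat \<Rightarrow> 'a topology \<Rightarrow> 'b topology \<Rightarrow> 'a cochain set \<Rightarrow> 'b cochain set
      \<Rightarrow> ('a \<times> 'b) cochain set" where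
  "cross_product p q X Y a b =
     cup_product p q (prod_topology X Y)
       (cohomology_pullback p (prod_topology X Y) fst a)
       (cohomology_pullback q (prod_topology X Y) snd b)"

text \<open>
  A family is a set of pairs \<open>(U, f)\<close>. The same \<open>U\<close> may carry several functions, which is needed
  for the union of two families to make sense.
\<close>

type_synonym 'a form_family = "('a set \<times> ('a \<Rightarrow> real)) set"

definition closed_form_family :: "'a topology \<Rightarrow> 'a form_family \<Rightarrow> bool" where
  "closed_form_family X \<F> \<longleftrightarrow>
     (\<forall>(U, f)\<in>\<F>. openin X U \<and> continuous_map (subtopology X U) euclideanreal f) \<and>
     (\<Union>(U, f)\<in>\<F>. U) = topspace X \<and>
     (\<forall>(U, f)\<in>\<F>. \<forall>(V, g)\<in>\<F>. \<forall>x\<in>U \<inter> V.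
        \<exists>W. openin X W \<and> x \<in> W \<and> W \<subseteq> U \<inter> V \<and> (\<lambda>y. f y - g y) constant_on W)"

definition same_form :: "'a topology \<Rightarrow> 'a form_family rel" where
  "same_form X = {(\<F>, \<G>). closed_form_family X \<F> \<and> closed_form_family X \<G> \<and>
                            closed_form_family X (\<F> \<union> \<G>)}"

definition closed_1_forms :: "'a topology \<Rightarrow> 'a form_family set set" where
  "closed_1_forms X = Collect (closed_form_family X) // same_form X"

text \<open>
  The value does not depend on the family \<open>\<F>\<close> in the class \<open>\<omega>\<close>, the subdivision \<open>t\<close>,
  or the members \<open>s i\<close> of the family.
\<close>

definition form_integral :: "'a form_family set \<Rightarrow> (real \<Rightarrow> 'a) \<Rightarrow> real" where
  "form_integral \<omega> \<gamma> = (THE r.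
     \<exists>\<F>\<in>\<omega>. \<exists>(m::nat) (t :: nat \<Rightarrow> real) (s :: nat \<Rightarrow> 'a set \<times> ('a \<Rightarrow> real)).
       t 0 = 0 \<and> t m = 1 \<and>
       (\<forall>i<m. t i < t (Suc i) \<and> s i \<in> \<F> \<and> \<gamma> ` {t i..t (Suc i)} \<subseteq> fst (s i)) \<and>
       r = (\<Sum>i<m. snd (s i) (\<gamma> (t (Suc i))) - snd (s i) (\<gamma> (t i))))"

text \<open>The singular 1-simplex running along a path from vertex 0 to vertex 1.\<close>

definition path_simplex :: "(real \<Rightarrow> 'a) \<Rightarrow> (nat \<Rightarrow> real) \<Rightarrow> 'a" where
  "path_simplex \<gamma> = restrict (\<lambda>x. \<gamma> (x 1)) (standard_simplex 1)"

text \<open>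
  A loop is a 1-cycle, so every cocycle in \<open>\<xi>\<close> has the same value on it, and by universal
  coefficients these values determine \<open>\<xi>\<close>.
\<close>

definition represents :: "'a topology \<Rightarrow> 'a form_family set \<Rightarrow> 'a cochain set \<Rightarrow> bool" where
  "represents X \<omega> \<xi> \<longleftrightarrow> \<omega> \<in> closed_1_forms X \<and> \<xi> \<in> cohomology 1 X \<and>
     (\<forall>\<phi>\<in>\<xi>. \<forall>\<gamma>. pathin X \<gamma> \<and> \<gamma> 0 = \<gamma> 1 \<longrightarrow> \<phi> (path_simplex \<gamma>) = form_integral \<omega> \<gamma>)"

text \<open>The path from \<open>x\<close> to \<open>h (t, x)\<close> along the homotopy is reparametrised to \<open>[0, 1]\<close>.\<close>

definition movable ::
    "'a topology \<Rightarrow> 'a form_family set \<Rightarrow> real \<Rightarrow> real \<Rightarrow> 'a set \<Rightarrow> bool" where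
  "movable X \<omega> N C A \<longleftrightarrow> A \<subseteq> topspace X \<and>
     (\<exists>h. continuous_map (prod_topology (top_of_set {0..1::real}) (subtopology X A)) X h \<and>
          (\<forall>x\<in>A. h (0, x) = x) \<and>
          (\<forall>x\<in>A. form_integral \<omega> (\<lambda>\<tau>. h (\<tau>, x)) < - N) \<and>
          (\<forall>x\<in>A. \<forall>t\<in>{0..1}. form_integral \<omega> (\<lambda>\<tau>. h (\<tau> * t, x)) \<le> C))"

definition null_homotopic_in :: "'a topology \<Rightarrow> 'a set \<Rightarrow> bool" where
  "null_homotopic_in X A \<longleftrightarrow>
     (\<exists>c. homotopic_with (\<lambda>_. True) (subtopology X A) X (\<lambda>x. x) (\<lambda>_. c))"

definition ccat_form :: "'a topology \<Rightarrow> 'a form_family set \<Rightarrow> enat" where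
  "ccat_form X \<omega> = Inf {enat k | k.
     \<exists>C>0. \<forall>N>0. \<exists>F (G :: nat \<Rightarrow> 'a set).
       openin X F \<and> movable X \<omega> N C F \<and>
       (\<forall>j\<in>{1..k}. openin X (G j) \<and> null_homotopic_in X (G j)) \<and>
       topspace X = F \<union> (\<Union>j\<in>{1..k}. G j)}"

text \<open>
  On a finite cell complex every class is represented, \<open>ccat_form X \<omega>\<close> is finite, and it is the
  same for all \<open>\<omega>\<close> representing \<open>\<xi>\<close>. The value \<open>\<infinity>\<close> only totalises the definition for
  spaces on which there is no representing form or no admissible cover.
\<close>

definition ccat :: "'a topology \<Rightarrow> 'a cochain set \<Rightarrow> enat" where
  "ccat X \<xi> = (if \<exists>\<omega>. represents X \<omega> \<xi> then ccat_form X (SOME \<omega>. represents X \<omega> \<xi>) else \<infinity>)"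

end

theory Submission
  imports Defs "HOL-Analysis.Urysohn"
begin

text \<open>
  Suppose both categories are finite, \<open>k\<close> for \<open>X\<close> and \<open>l\<close> for \<open>Y\<close>; otherwise the right-hand side is
  infinite. Let \<open>X = F \<union> A 1 \<union> \<dots> \<union> A k\<close> and \<open>Y = G \<union> B 1 \<union> \<dots> \<union> B l\<close> be covers by
  movable and null-homotopic open sets. The homotopy of \<open>F\<close>, cut off near the boundary of \<open>F\<close>, extends
  to a homotopy of \<open>X\<close> under which no integral exceeds the control and the integrals over a
  slightly smaller set are as negative as before (\<open>movable_extend\<close>); likewise for \<open>Y\<close>. Run
  simultaneously, the two homotopies move the points of \<open>X \<times> Y\<close> with one coordinate in
  (the smaller) \<open>F\<close> or \<open>G\<close>, because integrals of the product form are sums and the other coordinate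
  contributes at most its control. The remaining points lie in the products \<open>A i \<times> B j\<close>. As in the product
  inequality for the Lusternik-Schnirelmann category, they are covered by open sets, one for each value
  of \<open>i + j\<close>, each of which is a disjoint union of open subsets of products \<open>A i \<times> B j\<close>
  (\<open>product_cover\<close>). The values are \<open>2, \<dots>, k + l\<close>, which gives the bound \<open>k + l - 1\<close>. A disjoint union of
  open null-homotopic sets is null-homotopic in a path-connected space, and connected finite cell
  complexes are path-connected; if \<open>k\<close> or \<open>l\<close> is zero there are no such sets at all.

  This cover is movable with respect to the sum of the pullbacks of the two forms. That sum
  represents \<open>\<xi>\<close> (\<open>represents_cross_sum\<close>), but the category of the product is computed with an
  arbitrary form that represents \<open>\<xi>\<close>. The two forms have equal periods, so their integrals over any path
  differ by the increment of a potential, which is bounded because a finite cell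
  complex is a finite union of images of discs
  (\<open>same_periods_imp_integrals_boundedly_close\<close>). A bounded error only changes the control by a constant
  and the required drop \<open>N\<close> by the same constant.

  All computations with integrals rest on their description as increments of primitives along paths
  (\<open>form_integral_eq_primitive_increment\<close>).
\<close>

section \<open>Primitives of a closed 1-form along a path\<close>

text \<open>
  The antiderivative of the pulled-back form: the integral of the form along the restriction of
  the path to an initial segment, up to an additive constant. Describing it by a local condition,
  rather than by sums over subdivisions, makes gluing, reparametrization and sums of forms
  immediate.
\<close>

definition primitive_on ::
    "'a form_family \<Rightarrow> (real \<Rightarrow> 'a) \<Rightarrow> real \<Rightarrow> real \<Rightarrow> (real \<Rightarrow> real) \<Rightarrow> bool" where
  "primitive_on \<F> \<gamma> a b p \<longleftrightarrow>
     (\<forall>t\<in>{a..b}. \<forall>(U, f)\<in>\<F>. \<gamma> t \<in> U \<longrightarrow>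
        (\<exists>e>0. \<forall>s\<in>{a..b}. \<bar>s - t\<bar> < e \<longrightarrow> p s - f (\<gamma> s) = p t - f (\<gamma> t)))"

lemma primitive_onD:
  assumes "primitive_on \<F> \<gamma> a b p" "t \<in> {a..b}" "(U, f) \<in> \<F>" "\<gamma> t \<in> U"
  obtains e where "e > 0" "\<And>s. s \<in> {a..b} \<Longrightarrow> \<bar>s - t\<bar> < e \<Longrightarrow> p s - f (\<gamma> s) = p t - f (\<gamma> t)"
  using assms unfolding primitive_on_def by fast

text \<open>
  The compactness of an interval as an induction principle for properties of its subintervals,
  which replaces the choice of a common refinement or of a Lebesgue number.
\<close>

lemma Bolzano_subintervals:
  fixes a b :: real
  assumes "a \<le> b"
    and trans: "\<And>u v w. a \<le> u \<Longrightarrow> u \<le> v \<Longrightarrow> v \<le> w \<Longrightarrow> w \<le> b \<Longrightarrow> P u v \<Longrightarrow> P v w \<Longrightarrow> P u w"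
    and local: "\<And>x. x \<in> {a..b} \<Longrightarrow>
      \<exists>e>0. \<forall>u v. a \<le> u \<longrightarrow> u \<le> x \<longrightarrow> x \<le> v \<longrightarrow> v \<le> b \<longrightarrow> v - u < e \<longrightarrow> P u v"
  shows "P a b"
proof -
  have "a \<le> a \<and> b \<le> b \<longrightarrow> P a b"
  proof (rule Bolzano[where P = "\<lambda>u v. a \<le> u \<and> v \<le> b \<longrightarrow> P u v"])
    fix u v w assume "a \<le> u \<and> v \<le> b \<longrightarrow> P u v" "a \<le> v \<and> w \<le> b \<longrightarrow> P v w" "u \<le> v" "v \<le> w"
    then show "a \<le> u \<and> w \<le> b \<longrightarrow> P u w" using trans[of u v w] by linarith
  next
    fix x assume "a \<le> x" "x \<le> b"
    then show "\<exists>d>0. \<forall>u v. u \<le> x \<and> x \<le> v \<and> v - u < d \<longrightarrow> a \<le> u \<and> v \<le> b \<longrightarrow> P u v"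
      using local[of x] by (meson atLeastAtMost_iff)
  qed (rule \<open>a \<le> b\<close>)
  then show ?thesis by simp
qed

lemma locally_constant_imp_equal_ends:
  fixes g :: "real \<Rightarrow> real"
  assumes "a \<le> b"
    and loc: "\<And>t. t \<in> {a..b} \<Longrightarrow> \<exists>e>0. \<forall>s\<in>{a..b}. \<bar>s - t\<bar> < e \<longrightarrow> g s = g t"
  shows "g a = g b"
  using \<open>a \<le> b\<close>
proof (rule Bolzano_subintervals[where P = "\<lambda>u v. g u = g v"])
  fix x assume "x \<in> {a..b}"
  then obtain e where e: "e > 0" "\<And>s. s \<in> {a..b} \<Longrightarrow> \<bar>s - x\<bar> < e \<Longrightarrow> g s = g x"
    using loc by meson
  have "g u = g v" if "a \<le> u" "u \<le> x" "x \<le> v" "v \<le> b" "v - u < e" for u v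
    using e(2)[of u] e(2)[of v] that by simp
  with e(1) show "\<exists>e>0. \<forall>u v. a \<le> u \<longrightarrow> u \<le> x \<longrightarrow> x \<le> v \<longrightarrow> v \<le> b \<longrightarrow> v - u < e \<longrightarrow> g u = g v"
    by blast
qed simp

lemma closed_form_familyD:
  assumes "closed_form_family X \<F>"
  shows "\<And>U f. (U, f) \<in> \<F> \<Longrightarrow> openin X U"
    and "\<And>U f. (U, f) \<in> \<F> \<Longrightarrow> continuous_map (subtopology X U) euclideanreal f"
    and "\<And>x. x \<in> topspace X \<Longrightarrow> \<exists>U f. (U, f) \<in> \<F> \<and> x \<in> U"
    and "\<And>U f V g x. (U, f) \<in> \<F> \<Longrightarrow> (V, g) \<in> \<F> \<Longrightarrow> x \<in> U \<Longrightarrow> x \<in> V \<Longrightarrow>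
           \<exists>W. openin X W \<and> x \<in> W \<and> W \<subseteq> U \<inter> V \<and> (\<forall>y\<in>W. f y - g y = f x - g x)"
proof -
  note A = assms[unfolded closed_form_family_def]
  note A1 = conjunct1[OF A] and A2 = conjunct1[OF conjunct2[OF A]] and A3 = conjunct2[OF conjunct2[OF A]]
  show "openin X U" "continuous_map (subtopology X U) euclideanreal f" if "(U, f) \<in> \<F>" for U f
    using bspec[OF A1 that] by simp_all
  show "\<exists>U f. (U, f) \<in> \<F> \<and> x \<in> U" if "x \<in> topspace X" for x
  proof -
    have "x \<in> (\<Union>(U, f)\<in>\<F>. U)" using that A2 by (simp only:)
    then show ?thesis by (rule UN_E) (auto simp: split_def)
  qed
  show "\<exists>W. openin X W \<and> x \<in> W \<and> W \<subseteq> U \<inter> V \<and> (\<forall>y\<in>W. f y - g y = f x - g x)"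
    if UV: "(U, f) \<in> \<F>" "(V, g) \<in> \<F>" "x \<in> U" "x \<in> V" for U f V g x
  proof -
    have "\<exists>W. openin X W \<and> x \<in> W \<and> W \<subseteq> U \<inter> V \<and> (\<lambda>y. f y - g y) constant_on W"
      using bspec[OF bspec[OF A3 UV(1), unfolded split_conv] UV(2), unfolded split_conv] UV(3,4) by simp
    then obtain W c where W: "openin X W" "x \<in> W" "W \<subseteq> U \<inter> V" "\<And>y. y \<in> W \<Longrightarrow> f y - g y = c"
      unfolding constant_on_def by blast
    then have "\<forall>y\<in>W. f y - g y = f x - g x" by metis
    with W(1-3) show ?thesis by blast
  qed
qed

lemma closed_form_familyI:
  assumes "\<And>U f. (U, f) \<in> \<F> \<Longrightarrow> openin X U"
    and "\<And>U f. (U, f) \<in> \<F> \<Longrightarrow> continuous_map (subtopology X U) euclideanreal f"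
    and "\<And>x. x \<in> topspace X \<Longrightarrow> \<exists>U f. (U, f) \<in> \<F> \<and> x \<in> U"
    and "\<And>U f V g x. (U, f) \<in> \<F> \<Longrightarrow> (V, g) \<in> \<F> \<Longrightarrow> x \<in> U \<Longrightarrow> x \<in> V \<Longrightarrow>
           \<exists>W. openin X W \<and> x \<in> W \<and> W \<subseteq> U \<inter> V \<and> (\<forall>y\<in>W. f y - g y = f x - g x)"
  shows "closed_form_family X \<F>"
  unfolding closed_form_family_def
proof (intro conjI)
  show "\<forall>(U, f)\<in>\<F>. openin X U \<and> continuous_map (subtopology X U) euclideanreal f"
    using assms(1,2) by auto
  show "(\<Union>(U, f)\<in>\<F>. U) = topspace X"
  proof
    show "(\<Union>(U, f)\<in>\<F>. U) \<subseteq> topspace X" using openin_subset[OF assms(1)] by blast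
    show "topspace X \<subseteq> (\<Union>(U, f)\<in>\<F>. U)" using assms(3) by blast
  qed
  have "\<exists>W. openin X W \<and> x \<in> W \<and> W \<subseteq> U \<inter> V \<and> (\<lambda>y. f y - g y) constant_on W"
    if "(U, f) \<in> \<F>" "(V, g) \<in> \<F>" "x \<in> U" "x \<in> V" for U f V g x
    using assms(4)[OF that] unfolding constant_on_def by blast
  then show "\<forall>(U, f)\<in>\<F>. \<forall>(V, g)\<in>\<F>. \<forall>x\<in>U \<inter> V.
      \<exists>W. openin X W \<and> x \<in> W \<and> W \<subseteq> U \<inter> V \<and> (\<lambda>y. f y - g y) constant_on W"
    by (intro ballI) (simp add: split_paired_all)
qed

lemma path_stays_in_open:
  assumes "continuous_map (top_of_set {a..b::real}) X \<gamma>" "openin X W" "t \<in> {a..b}" "\<gamma> t \<in> W"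
  obtains e where "e > 0" "\<And>s. s \<in> {a..b} \<Longrightarrow> \<bar>s - t\<bar> < e \<Longrightarrow> \<gamma> s \<in> W"
proof -
  have "openin (top_of_set {a..b}) {s \<in> topspace (top_of_set {a..b}). \<gamma> s \<in> W}"
    using assms(1,2) by (rule openin_continuous_map_preimage)
  then obtain e where "e > 0" "\<forall>s\<in>{a..b}. dist s t < e \<longrightarrow> s \<in> {s \<in> topspace (top_of_set {a..b}). \<gamma> s \<in> W}"
    using assms(3,4) unfolding openin_euclidean_subtopology_iff by fastforce
  then show ?thesis using that by (auto simp: dist_real_def)
qed

text \<open>
  Two families of the same form differ by locally constant functions, so a primitive depends only
  on the form and not on the family that presents it.
\<close>

lemma primitive_on_change_family:
  assumes "closed_form_family X \<F>" and cl: "closed_form_family X (\<F> \<union> \<G>)"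
    and path: "continuous_map (top_of_set {a..b}) X \<gamma>" and p: "primitive_on \<F> \<gamma> a b p"
  shows "primitive_on \<G> \<gamma> a b p"
  unfolding primitive_on_def
proof (clarify)
  fix t V g assume t: "t \<in> {a..b}" and V: "(V, g) \<in> \<G>" "\<gamma> t \<in> V"
  have "\<gamma> t \<in> topspace X" using path t by (auto simp: continuous_map_def)
  then obtain U f where U: "(U, f) \<in> \<F>" "\<gamma> t \<in> U"
    using closed_form_familyD(3)[OF assms(1)] by blast
  obtain W where W: "openin X W" "\<gamma> t \<in> W" "\<And>y. y \<in> W \<Longrightarrow> f y - g y = f (\<gamma> t) - g (\<gamma> t)"
    using closed_form_familyD(4)[OF cl, of U f V g "\<gamma> t"] U V by blast
  obtain d where d: "d > 0" "\<And>s. s \<in> {a..b} \<Longrightarrow> \<bar>s - t\<bar> < d \<Longrightarrow> \<gamma> s \<in> W"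
    using path_stays_in_open[OF path W(1) t W(2)] by blast
  obtain e where e: "e > 0" "\<And>s. s \<in> {a..b} \<Longrightarrow> \<bar>s - t\<bar> < e \<Longrightarrow> p s - f (\<gamma> s) = p t - f (\<gamma> t)"
    using primitive_onD[OF p t U] by blast
  have "p s - g (\<gamma> s) = p t - g (\<gamma> t)" if "s \<in> {a..b}" "\<bar>s - t\<bar> < min d e" for s
    using d(2)[of s] e(2)[of s] W(3)[of "\<gamma> s"] that by auto
  then show "\<exists>e>0. \<forall>s\<in>{a..b}. \<bar>s - t\<bar> < e \<longrightarrow> p s - g (\<gamma> s) = p t - g (\<gamma> t)"
    using d(1) e(1) by (intro exI[of _ "min d e"]) auto
qed

lemma primitive_on_within_member:
  assumes cl: "closed_form_family X \<F>" and path: "continuous_map (top_of_set {a..b}) X \<gamma>"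
    and U: "(U, f) \<in> \<F>" "\<gamma> ` {a..b} \<subseteq> U"
  shows "primitive_on \<F> \<gamma> a b (\<lambda>t. f (\<gamma> t))"
  unfolding primitive_on_def
proof (clarify)
  fix t V g assume t: "t \<in> {a..b}" and V: "(V, g) \<in> \<F>" "\<gamma> t \<in> V"
  have "\<gamma> t \<in> U" using U(2) t by auto
  then obtain W where W: "openin X W" "\<gamma> t \<in> W" "\<And>y. y \<in> W \<Longrightarrow> f y - g y = f (\<gamma> t) - g (\<gamma> t)"
    using closed_form_familyD(4)[OF cl U(1) V(1) _ V(2)] by blast
  obtain d where d: "d > 0" "\<And>s. s \<in> {a..b} \<Longrightarrow> \<bar>s - t\<bar> < d \<Longrightarrow> \<gamma> s \<in> W"
    using path_stays_in_open[OF path W(1) t W(2)] by blast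
  then show "\<exists>e>0. \<forall>s\<in>{a..b}. \<bar>s - t\<bar> < e \<longrightarrow> f (\<gamma> s) - g (\<gamma> s) = f (\<gamma> t) - g (\<gamma> t)"
    using W(3) by blast
qed

text \<open>
  On a piece of the path inside one member of the family, the primitive and the member's function
  differ by a locally constant function on an interval. This ties the local description to the
  summands in the definition of the integral.
\<close>

lemma primitive_on_increment_in_member:
  assumes p: "primitive_on \<F> \<gamma> a b p" and U: "(U, f) \<in> \<F>" "\<gamma> ` {u..v} \<subseteq> U"
    and uv: "a \<le> u" "u \<le> v" "v \<le> b"
  shows "p v - p u = f (\<gamma> v) - f (\<gamma> u)"
proof -
  have "p u - f (\<gamma> u) = p v - f (\<gamma> v)"
  proof (rule locally_constant_imp_equal_ends[OF uv(2)])
    fix t assume t: "t \<in> {u..v}"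
    then have "t \<in> {a..b}" "\<gamma> t \<in> U" using uv U(2) by auto
    then obtain e where "e > 0" "\<And>s. s \<in> {a..b} \<Longrightarrow> \<bar>s - t\<bar> < e \<Longrightarrow> p s - f (\<gamma> s) = p t - f (\<gamma> t)"
      using primitive_onD[OF p _ U(1)] by blast
    then show "\<exists>e>0. \<forall>s\<in>{u..v}. \<bar>s - t\<bar> < e \<longrightarrow> p s - f (\<gamma> s) = p t - f (\<gamma> t)"
      using uv by (intro exI[of _ e]) auto
  qed
  then show ?thesis by simp
qed

lemma primitive_on_shift:
  assumes "primitive_on \<F> \<gamma> a b p"
  shows "primitive_on \<F> \<gamma> a b (\<lambda>t. p t + c)"
  using assms unfolding primitive_on_def by (simp add: algebra_simps)

lemma primitive_on_cong:
  assumes "primitive_on \<F> \<gamma> a b p" "\<And>t. t \<in> {a..b} \<Longrightarrow> \<gamma> t = \<delta> t \<and> p t = q t"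
  shows "primitive_on \<F> \<delta> a b q"
  unfolding primitive_on_def
proof clarify
  fix t U f assume t: "t \<in> {a..b}" and U: "(U, f) \<in> \<F>" "\<delta> t \<in> U"
  have "\<gamma> t \<in> U" using assms(2)[OF t] U(2) by simp
  then obtain e where e: "e > 0" "\<And>s. s \<in> {a..b} \<Longrightarrow> \<bar>s - t\<bar> < e \<Longrightarrow> p s - f (\<gamma> s) = p t - f (\<gamma> t)"
    using primitive_onD[OF assms(1) t U(1)] by blast
  have "q s - f (\<delta> s) = q t - f (\<delta> t)" if "s \<in> {a..b}" "\<bar>s - t\<bar> < e" for s
    using e(2)[OF that] assms(2)[OF that(1)] assms(2)[OF t] by simp
  with e(1) show "\<exists>e>0. \<forall>s\<in>{a..b}. \<bar>s - t\<bar> < e \<longrightarrow> q s - f (\<delta> s) = q t - f (\<delta> t)"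
    by blast
qed

lemma primitive_on_glue:
  assumes p1: "primitive_on \<F> \<gamma> a b p" and p2: "primitive_on \<F> \<gamma> b c p"
  shows "primitive_on \<F> \<gamma> a c p"
  unfolding primitive_on_def
proof clarify
  fix t U f assume t: "t \<in> {a..c}" and U: "(U, f) \<in> \<F>" "\<gamma> t \<in> U"
  have 1: "\<exists>e>0. \<forall>s. a \<le> s \<and> s \<le> b \<and> \<bar>s - t\<bar> < e \<longrightarrow> p s - f (\<gamma> s) = p t - f (\<gamma> t)"
  proof (cases "t \<le> b")
    case True
    then have "t \<in> {a..b}" using t by simp
    from primitive_onD[OF p1 this U] obtain e where
      "e > 0" "\<And>s. s \<in> {a..b} \<Longrightarrow> \<bar>s - t\<bar> < e \<Longrightarrow> p s - f (\<gamma> s) = p t - f (\<gamma> t)"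
      by blast
    then show ?thesis by (intro exI[of _ e]) simp
  next
    case False
    then show ?thesis by (intro exI[of _ "t - b"]) auto
  qed
  have 2: "\<exists>e>0. \<forall>s. b \<le> s \<and> s \<le> c \<and> \<bar>s - t\<bar> < e \<longrightarrow> p s - f (\<gamma> s) = p t - f (\<gamma> t)"
  proof (cases "b \<le> t")
    case True
    then have "t \<in> {b..c}" using t by simp
    from primitive_onD[OF p2 this U] obtain e where
      "e > 0" "\<And>s. s \<in> {b..c} \<Longrightarrow> \<bar>s - t\<bar> < e \<Longrightarrow> p s - f (\<gamma> s) = p t - f (\<gamma> t)"
      by blast
    then show ?thesis by (intro exI[of _ e]) simp
  next
    case False
    then show ?thesis by (intro exI[of _ "b - t"]) auto
  qed
  obtain d where "d > 0"
    and d: "\<And>s. a \<le> s \<and> s \<le> b \<and> \<bar>s - t\<bar> < d \<Longrightarrow> p s - f (\<gamma> s) = p t - f (\<gamma> t)"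
    using 1 by blast
  obtain e where "e > 0"
    and e: "\<And>s. b \<le> s \<and> s \<le> c \<and> \<bar>s - t\<bar> < e \<Longrightarrow> p s - f (\<gamma> s) = p t - f (\<gamma> t)"
    using 2 by blast
  have "p s - f (\<gamma> s) = p t - f (\<gamma> t)" if "s \<in> {a..c}" "\<bar>s - t\<bar> < min d e" for s
    using d[of s] e[of s] that by (cases "s \<le> b") auto
  then show "\<exists>e>0. \<forall>s\<in>{a..c}. \<bar>s - t\<bar> < e \<longrightarrow> p s - f (\<gamma> s) = p t - f (\<gamma> t)"
    using \<open>d > 0\<close> \<open>e > 0\<close> by (intro exI[of _ "min d e"]) auto
qed

lemma primitive_on_reparametrize:
  assumes p: "primitive_on \<F> \<gamma> c d p" and \<phi>: "continuous_on {a..b} \<phi>" "\<phi> ` {a..b} \<subseteq> {c..d}"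
  shows "primitive_on \<F> (\<lambda>t. \<gamma> (\<phi> t)) a b (\<lambda>t. p (\<phi> t))"
  unfolding primitive_on_def
proof clarify
  fix t U f assume t: "t \<in> {a..b}" and U: "(U, f) \<in> \<F>" "\<gamma> (\<phi> t) \<in> U"
  have "\<phi> t \<in> {c..d}" using t \<phi>(2) by blast
  then obtain e where e: "e > 0"
      "\<And>s. s \<in> {c..d} \<Longrightarrow> \<bar>s - \<phi> t\<bar> < e \<Longrightarrow> p s - f (\<gamma> s) = p (\<phi> t) - f (\<gamma> (\<phi> t))"
    using primitive_onD[OF p _ U] by blast
  obtain r where r: "r > 0" "\<And>s. s \<in> {a..b} \<Longrightarrow> \<bar>s - t\<bar> < r \<Longrightarrow> \<bar>\<phi> s - \<phi> t\<bar> < e"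
    using \<phi>(1) t e(1) unfolding continuous_on_iff dist_real_def by blast
  have "p (\<phi> s) - f (\<gamma> (\<phi> s)) = p (\<phi> t) - f (\<gamma> (\<phi> t))" if "s \<in> {a..b}" "\<bar>s - t\<bar> < r" for s
    using e(2)[of "\<phi> s"] r(2)[of s] that \<phi>(2) by blast
  with r(1) show "\<exists>e>0. \<forall>s\<in>{a..b}. \<bar>s - t\<bar> < e \<longrightarrow>
      p (\<phi> s) - f (\<gamma> (\<phi> s)) = p (\<phi> t) - f (\<gamma> (\<phi> t))" by blast
qed

text \<open>
  Both exist on short intervals, where the path stays in one member, and both can be
  concatenated; so both exist on the whole interval.
\<close>

lemma exists_primitive_and_subdivision:
  assumes cl: "closed_form_family X \<F>" and path: "continuous_map (top_of_set {c..d}) X \<gamma>" and "c \<le> d"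
  shows "(\<exists>p. primitive_on \<F> \<gamma> c d p) \<and>
    (\<exists>(m::nat) t s. t 0 = c \<and> t m = d \<and>
       (\<forall>i<m. t i < t (Suc i) \<and> s i \<in> \<F> \<and> \<gamma> ` {t i..t (Suc i)} \<subseteq> fst (s i)))"
proof -
  define S where "S a b \<longleftrightarrow> (\<exists>(m::nat) t s. t 0 = a \<and> t m = b \<and>
       (\<forall>i<m. t i < t (Suc i) \<and> s i \<in> \<F> \<and> \<gamma> ` {t i..t (Suc i)} \<subseteq> fst (s i)))" for a b
  have "(\<exists>p. primitive_on \<F> \<gamma> c d p) \<and> S c d"
    using \<open>c \<le> d\<close>
  proof (rule Bolzano_subintervals[where P = "\<lambda>u v. (\<exists>p. primitive_on \<F> \<gamma> u v p) \<and> S u v"])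
    fix u v w assume "(\<exists>p. primitive_on \<F> \<gamma> u v p) \<and> S u v" "(\<exists>p. primitive_on \<F> \<gamma> v w p) \<and> S v w"
    then obtain p q where p: "primitive_on \<F> \<gamma> u v p" and q: "primitive_on \<F> \<gamma> v w q"
        and S: "S u v" "S v w"
        by blast
      define r where "r t = (if t \<le> v then p t else q t + (p v - q v))" for t
      have "primitive_on \<F> \<gamma> u v r"
        using p by (rule primitive_on_cong) (auto simp: r_def)
      moreover have "primitive_on \<F> \<gamma> v w r"
        using primitive_on_shift[OF q] by (rule primitive_on_cong) (auto simp: r_def)
      ultimately have r: "primitive_on \<F> \<gamma> u w r"
        by (rule primitive_on_glue)
      obtain m t s where 1: "t 0 = u" "t (m::nat) = v"
        "\<And>i. i < m \<Longrightarrow> t i < t (Suc i) \<and> s i \<in> \<F> \<and> \<gamma> ` {t i..t (Suc i)} \<subseteq> fst (s i)"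
        using S(1) unfolding S_def by blast
      obtain m' t' s' where 2: "t' 0 = v" "t' (m'::nat) = w"
        "\<And>i. i < m' \<Longrightarrow> t' i < t' (Suc i) \<and> s' i \<in> \<F> \<and> \<gamma> ` {t' i..t' (Suc i)} \<subseteq> fst (s' i)"
        using S(2) unfolding S_def by blast
      define t'' where "t'' i = (if i \<le> m then t i else t' (i - m))" for i
      define s'' where "s'' i = (if i < m then s i else s' (i - m))" for i
      have *: "t'' i < t'' (Suc i) \<and> s'' i \<in> \<F> \<and> \<gamma> ` {t'' i..t'' (Suc i)} \<subseteq> fst (s'' i)"
        if "i < m + m'" for i
      proof (cases "i < m")
        case True
        then show ?thesis using 1(3)[of i] by (simp add: t''_def s''_def)
      next
        case False
        then have "t'' i = t' (i - m)" "t'' (Suc i) = t' (Suc (i - m))" "s'' i = s' (i - m)"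
          using 1(2) 2(1) by (auto simp: t''_def s''_def Suc_diff_le)
        then show ?thesis using 2(3)[of "i - m"] that False by simp
      qed
      have "t'' 0 = u" "t'' (m + m') = w" using 1 2 by (auto simp: t''_def)
      with * have "S u w" unfolding S_def by blast
      with r show "(\<exists>p. primitive_on \<F> \<gamma> u w p) \<and> S u w" by blast
  next
    fix x assume x: "x \<in> {c..d}"
    have "\<gamma> x \<in> topspace X" using path x by (auto simp: continuous_map_def)
    then obtain U f where U: "(U, f) \<in> \<F>" "\<gamma> x \<in> U"
      using closed_form_familyD(3)[OF cl] by blast
    obtain e where e: "e > 0" "\<And>s. s \<in> {c..d} \<Longrightarrow> \<bar>s - x\<bar> < e \<Longrightarrow> \<gamma> s \<in> U"
      using path_stays_in_open[OF path closed_form_familyD(1)[OF cl U(1)] x U(2)] by blast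
    have "(\<exists>p. primitive_on \<F> \<gamma> u v p) \<and> S u v"
      if uv: "c \<le> u" "u \<le> x" "x \<le> v" "v \<le> d" "v - u < e" for u v
    proof -
      have sub: "{u..v} \<subseteq> {c..d}" using uv by auto
      have U': "\<gamma> ` {u..v} \<subseteq> U" using e(2) uv sub by force
      have "continuous_map (top_of_set {u..v}) X \<gamma>"
        using path sub by (rule continuous_map_from_subtopology_mono)
      then have "primitive_on \<F> \<gamma> u v (\<lambda>t. f (\<gamma> t))"
        using primitive_on_within_member[OF cl _ U(1) U'] by blast
      moreover have "S u v"
      proof (cases "u = v")
        case True
        then show ?thesis unfolding S_def by (intro exI[of _ 0] exI[of _ "\<lambda>_. u"]) auto
      next
        case False
        then show ?thesis unfolding S_def using uv U U'
          by (intro exI[of _ 1] exI[of _ "\<lambda>i. if i = 0 then u else v"] exI[of _ "\<lambda>_. (U, f)"]) auto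
      qed
      ultimately show "(\<exists>p. primitive_on \<F> \<gamma> u v p) \<and> S u v" by blast
    qed
    with e(1) show "\<exists>e>0. \<forall>u v. c \<le> u \<longrightarrow> u \<le> x \<longrightarrow> x \<le> v \<longrightarrow> v \<le> d \<longrightarrow> v - u < e \<longrightarrow>
        (\<exists>p. primitive_on \<F> \<gamma> u v p) \<and> S u v" by blast
  qed
  then show ?thesis unfolding S_def by simp
qed

section \<open>The integral of a closed 1-form\<close>

text \<open>
  Being families of the same form is transitive: locally, both families can be compared with a
  member of the third one.
\<close>

lemma closed_form_family_union_trans:
  assumes F: "closed_form_family X \<F>"
    and G: "closed_form_family X \<G>" and FG: "closed_form_family X (\<F> \<union> \<G>)"
    and H: "closed_form_family X \<H>" and FH: "closed_form_family X (\<F> \<union> \<H>)"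
  shows "closed_form_family X (\<G> \<union> \<H>)"
proof (rule closed_form_familyI)
  show "openin X U" "continuous_map (subtopology X U) euclideanreal f"
    if "(U, f) \<in> \<G> \<union> \<H>" for U f
    using closed_form_familyD(1,2)[OF G] closed_form_familyD(1,2)[OF H] that by blast+
next
  fix U f V g x assume UV: "(U, f) \<in> \<G> \<union> \<H>" "(V, g) \<in> \<G> \<union> \<H>" "x \<in> U" "x \<in> V"
  have "openin X U"
    using UV closed_form_familyD(1)[OF G] closed_form_familyD(1)[OF H] by blast
  then have "x \<in> topspace X" using openin_subset UV by blast
  then obtain T k where T: "(T, k) \<in> \<F>" "x \<in> T"
    using closed_form_familyD(3)[OF F] by blast
  have *: "\<exists>W. openin X W \<and> x \<in> W \<and> W \<subseteq> U \<inter> T \<and> (\<forall>y\<in>W. f y - k y = f x - k x)"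
    if "(U, f) \<in> \<G> \<union> \<H>" "x \<in> U" for U f
    using that(1)
  proof
    assume "(U, f) \<in> \<G>"
    then have "(U, f) \<in> \<F> \<union> \<G>" "(T, k) \<in> \<F> \<union> \<G>" using T(1) by simp_all
    from closed_form_familyD(4)[OF FG this that(2) T(2)] show ?thesis .
  next
    assume "(U, f) \<in> \<H>"
    then have "(U, f) \<in> \<F> \<union> \<H>" "(T, k) \<in> \<F> \<union> \<H>" using T(1) by simp_all
    from closed_form_familyD(4)[OF FH this that(2) T(2)] show ?thesis .
  qed
  obtain W1 where W1: "openin X W1" "x \<in> W1" "W1 \<subseteq> U \<inter> T" "\<And>y. y \<in> W1 \<Longrightarrow> f y - k y = f x - k x"
    using *[OF UV(1,3)] by blast
  obtain W2 where W2: "openin X W2" "x \<in> W2" "W2 \<subseteq> V \<inter> T" "\<And>y. y \<in> W2 \<Longrightarrow> g y - k y = g x - k x"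
    using *[OF UV(2,4)] by blast
  have "f y - g y = f x - g x" if "y \<in> W1 \<inter> W2" for y
    using W1(4)[of y] W2(4)[of y] that by auto
  moreover have "openin X (W1 \<inter> W2)" "x \<in> W1 \<inter> W2" "W1 \<inter> W2 \<subseteq> U \<inter> V"
    using W1(1-3) W2(1-3) by auto
  ultimately show "\<exists>W. openin X W \<and> x \<in> W \<and> W \<subseteq> U \<inter> V \<and> (\<forall>y\<in>W. f y - g y = f x - g x)"
    by blast
next
  show "\<exists>U f. (U, f) \<in> \<G> \<union> \<H> \<and> x \<in> U" if "x \<in> topspace X" for x
    using closed_form_familyD(3)[OF G that] by blast
qed

lemma closed_1_forms_members:
  assumes "\<omega> \<in> closed_1_forms X"
  shows "\<exists>\<F>. \<F> \<in> \<omega>" and "\<F> \<in> \<omega> \<Longrightarrow> closed_form_family X \<F>"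
    and "\<F> \<in> \<omega> \<Longrightarrow> \<G> \<in> \<omega> \<Longrightarrow> closed_form_family X (\<F> \<union> \<G>)"
proof -
  obtain \<F>\<^sub>0 where F0: "closed_form_family X \<F>\<^sub>0" and \<omega>: "\<omega> = same_form X `` {\<F>\<^sub>0}"
    using assms unfolding closed_1_forms_def quotient_def by auto
  have *: "closed_form_family X \<F> \<and> closed_form_family X (\<F>\<^sub>0 \<union> \<F>)" if "\<F> \<in> \<omega>" for \<F>
    using that unfolding \<omega> same_form_def by auto
  show "\<exists>\<F>. \<F> \<in> \<omega>" using F0 unfolding \<omega> same_form_def by auto
  show "closed_form_family X \<F>" if "\<F> \<in> \<omega>" using * that by blast
  show "closed_form_family X (\<F> \<union> \<G>)" if "\<F> \<in> \<omega>" "\<G> \<in> \<omega>"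
    using closed_form_family_union_trans[OF F0] * that by blast
qed

text \<open>
  Every admissible sum telescopes to the increment of the primitive, so the description that
  defines the integral is satisfied by exactly one number.
\<close>

lemma form_integral_eq_primitive_increment:
  assumes \<omega>: "\<omega> \<in> closed_1_forms X" and F: "\<F> \<in> \<omega>" and path: "pathin X \<gamma>"
    and p: "primitive_on \<F> \<gamma> 0 1 p"
  shows "form_integral \<omega> \<gamma> = p 1 - p 0"
proof -
  define sub where "sub \<G> m t s \<longleftrightarrow> t 0 = 0 \<and> t m = 1 \<and>
      (\<forall>i<m. t i < t (Suc i) \<and> s i \<in> \<G> \<and> \<gamma> ` {t i..t (Suc i)} \<subseteq> fst (s i))"
    for \<G> :: "'a form_family" and m :: nat and t s
  have path': "continuous_map (top_of_set {0..1}) X \<gamma>" using path unfolding pathin_def .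
  have sum_eq: "(\<Sum>i<m. snd (s i) (\<gamma> (t (Suc i))) - snd (s i) (\<gamma> (t i))) = p 1 - p 0"
    if G: "\<G> \<in> \<omega>" and s: "sub \<G> m t s" for \<G> m t s
  proof -
    have q: "primitive_on \<G> \<gamma> 0 1 p"
      using primitive_on_change_family[OF _ _ path' p] closed_1_forms_members[OF \<omega>] F G by blast
    have mono: "t i \<le> t j" if "i \<le> j" "j \<le> m" for i j
      using that
    proof (induction j rule: dec_induct)
      case (step j)
      then have "t j < t (Suc j)" using s by (auto simp: sub_def)
      with step show ?case by auto
    qed simp
    have "snd (s i) (\<gamma> (t (Suc i))) - snd (s i) (\<gamma> (t i)) = p (t (Suc i)) - p (t i)" if "i < m" for i
    proof -
      have "t 0 \<le> t i" "t i \<le> t (Suc i)" "t (Suc i) \<le> t m"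
        using mono[of 0 i] mono[of i "Suc i"] mono[of "Suc i" m] that by auto
      moreover have "(fst (s i), snd (s i)) \<in> \<G>" "\<gamma> ` {t i..t (Suc i)} \<subseteq> fst (s i)" "t 0 = 0" "t m = 1"
        using s that by (auto simp: sub_def)
      ultimately show ?thesis
        using primitive_on_increment_in_member[OF q] by metis
    qed
    then have "(\<Sum>i<m. snd (s i) (\<gamma> (t (Suc i))) - snd (s i) (\<gamma> (t i))) = (\<Sum>i<m. p (t (Suc i)) - p (t i))"
      by simp
    also have "\<dots> = p (t m) - p (t 0)"
      by (rule sum_lessThan_telescope)
    also have "\<dots> = p 1 - p 0"
      using s by (simp add: sub_def)
    finally show ?thesis .
  qed
  obtain m t s where ts: "sub \<F> m t s"
    using conjunct2[OF exists_primitive_and_subdivision[OF closed_1_forms_members(2)[OF \<omega> F] path' zero_le_one]]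
    unfolding sub_def by blast
  show ?thesis
    unfolding form_integral_def
  proof (rule the_equality)
    show "\<exists>\<F>\<in>\<omega>. \<exists>(m::nat) (t :: nat \<Rightarrow> real) (s :: nat \<Rightarrow> 'a set \<times> ('a \<Rightarrow> real)).
       t 0 = 0 \<and> t m = 1 \<and>
       (\<forall>i<m. t i < t (Suc i) \<and> s i \<in> \<F> \<and> \<gamma> ` {t i..t (Suc i)} \<subseteq> fst (s i)) \<and>
       p 1 - p 0 = (\<Sum>i<m. snd (s i) (\<gamma> (t (Suc i))) - snd (s i) (\<gamma> (t i)))"
      using F ts sum_eq[OF F ts, symmetric] unfolding sub_def by blast
  next
    fix r assume "\<exists>\<F>\<in>\<omega>. \<exists>(m::nat) (t :: nat \<Rightarrow> real) (s :: nat \<Rightarrow> 'a set \<times> ('a \<Rightarrow> real)).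
       t 0 = 0 \<and> t m = 1 \<and>
       (\<forall>i<m. t i < t (Suc i) \<and> s i \<in> \<F> \<and> \<gamma> ` {t i..t (Suc i)} \<subseteq> fst (s i)) \<and>
       r = (\<Sum>i<m. snd (s i) (\<gamma> (t (Suc i))) - snd (s i) (\<gamma> (t i)))"
    then obtain \<G> m t s where "\<G> \<in> \<omega>" "sub \<G> m t s"
      and "r = (\<Sum>i<m. snd (s i) (\<gamma> (t (Suc i))) - snd (s i) (\<gamma> (t i)))"
      unfolding sub_def by blast
    then show "r = p 1 - p 0" using sum_eq by simp
  qed
qed

lemma obtain_primitive:
  assumes "\<omega> \<in> closed_1_forms X" "\<F> \<in> \<omega>" "pathin X \<gamma>"
  obtains p where "primitive_on \<F> \<gamma> 0 1 p" "form_integral \<omega> \<gamma> = p 1 - p 0"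
  using exists_primitive_and_subdivision[OF closed_1_forms_members(2)[OF assms(1,2)]]
    form_integral_eq_primitive_increment[OF assms] assms(3) unfolding pathin_def by (metis zero_le_one)

lemma form_integral_const:
  assumes "\<omega> \<in> closed_1_forms X" "x \<in> topspace X" "\<And>t. t \<in> {0..1} \<Longrightarrow> \<gamma> t = x"
  shows "form_integral \<omega> \<gamma> = 0"
proof -
  obtain \<F> where F: "\<F> \<in> \<omega>" using closed_1_forms_members(1)[OF assms(1)] by blast
  have "continuous_map (top_of_set {0..1}) X (\<lambda>_::real. x)"
    using assms(2) by simp
  then have "pathin X \<gamma>"
    unfolding pathin_def by (rule continuous_map_eq) (simp add: assms(3))
  moreover have "primitive_on \<F> \<gamma> 0 1 (\<lambda>_. 0)"
    unfolding primitive_on_def by (auto simp: assms(3) intro!: exI[of _ 1])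
  ultimately show ?thesis
    using form_integral_eq_primitive_increment[OF assms(1) F, of \<gamma> "\<lambda>_. 0"] by simp
qed

lemma pathin_reparametrize:
  assumes "pathin X \<gamma>" "continuous_on {0..1} \<phi>" "\<phi> ` {0..1} \<subseteq> {0..1}"
  shows "pathin X (\<lambda>t. \<gamma> (\<phi> t))"
proof -
  have "continuous_map (top_of_set {0..1::real}) (top_of_set {0..1::real}) \<phi>"
    using assms(2,3) by (simp add: continuous_map_in_subtopology image_subset_iff_funcset)
  from continuous_map_compose[OF this assms(1)[unfolded pathin_def]]
  show ?thesis by (simp add: pathin_def o_def)
qed

lemma form_integral_reverse:
  assumes "\<omega> \<in> closed_1_forms X" "pathin X \<gamma>"
  shows "form_integral \<omega> (\<lambda>t. \<gamma> (1 - t)) = - form_integral \<omega> \<gamma>"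
proof -
  obtain \<F> where F: "\<F> \<in> \<omega>" using closed_1_forms_members(1)[OF assms(1)] by blast
  obtain p where p: "primitive_on \<F> \<gamma> 0 1 p" "form_integral \<omega> \<gamma> = p 1 - p 0"
    using obtain_primitive[OF assms(1) F assms(2)] .
  have \<phi>: "continuous_on {0..1} (\<lambda>t::real. 1 - t)" "(\<lambda>t::real. 1 - t) ` {0..1} \<subseteq> {0..1}"
    by (auto intro!: continuous_intros)
  show ?thesis
    using form_integral_eq_primitive_increment[OF assms(1) F pathin_reparametrize[OF assms(2) \<phi>]
        primitive_on_reparametrize[OF p(1) \<phi>]] p(2) by simp
qed

definition path_join :: "(real \<Rightarrow> 'a) \<Rightarrow> (real \<Rightarrow> 'a) \<Rightarrow> real \<Rightarrow> 'a" where
  "path_join \<gamma> \<delta> t = (if t \<le> 1/2 then \<gamma> (2 * t) else \<delta> (2 * t - 1))"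

lemma pathin_path_join:
  assumes "pathin X \<gamma>" "pathin X \<delta>" "\<gamma> 1 = \<delta> 0"
  shows "pathin X (path_join \<gamma> \<delta>)"
  unfolding pathin_def path_join_def
proof (intro continuous_map_cases_le)
  let ?A = "subtopology (top_of_set {0..1::real}) {x \<in> topspace (top_of_set {0..1}). x \<le> 1/2}"
  let ?B = "subtopology (top_of_set {0..1::real}) {x \<in> topspace (top_of_set {0..1}). 1/2 \<le> x}"
  have "continuous_map ?A (top_of_set {0..1}) (\<lambda>t. 2 * t)"
    by (auto simp: continuous_map_in_subtopology subtopology_subtopology intro!: continuous_intros)
  from continuous_map_compose[OF this assms(1)[unfolded pathin_def]]
  show "continuous_map ?A X (\<lambda>t. \<gamma> (2 * t))" by (simp add: o_def)
  have "continuous_map ?B (top_of_set {0..1}) (\<lambda>t. 2 * t - 1)"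
    by (auto simp: continuous_map_in_subtopology subtopology_subtopology intro!: continuous_intros)
  from continuous_map_compose[OF this assms(2)[unfolded pathin_def]]
  show "continuous_map ?B X (\<lambda>t. \<delta> (2 * t - 1))" by (simp add: o_def)
next
  fix t :: real assume "t = 1/2"
  then have "2 * t = 1" "2 * t - 1 = 0" by simp_all
  then show "\<gamma> (2 * t) = \<delta> (2 * t - 1)" using assms(3) by (simp only:)
qed auto

lemma form_integral_path_join:
  assumes \<omega>: "\<omega> \<in> closed_1_forms X" and "pathin X \<gamma>" "pathin X \<delta>" "\<gamma> 1 = \<delta> 0"
  shows "form_integral \<omega> (path_join \<gamma> \<delta>) = form_integral \<omega> \<gamma> + form_integral \<omega> \<delta>"
proof -
  obtain \<F> where F: "\<F> \<in> \<omega>" using closed_1_forms_members(1)[OF \<omega>] by blast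
  obtain p where p: "primitive_on \<F> \<gamma> 0 1 p" "form_integral \<omega> \<gamma> = p 1 - p 0"
    using obtain_primitive[OF \<omega> F assms(2)] .
  obtain q where q: "primitive_on \<F> \<delta> 0 1 q" "form_integral \<omega> \<delta> = q 1 - q 0"
    using obtain_primitive[OF \<omega> F assms(3)] .
  define r where "r t = (if t \<le> 1/2 then p (2 * t) else q (2 * t - 1) + (p 1 - q 0))" for t :: real
  have "primitive_on \<F> (\<lambda>t. \<gamma> (2 * t)) 0 (1/2) (\<lambda>t. p (2 * t))"
    by (rule primitive_on_reparametrize[OF p(1)]) (auto intro!: continuous_intros)
  then have "primitive_on \<F> (path_join \<gamma> \<delta>) 0 (1/2) r"
    by (rule primitive_on_cong) (auto simp: path_join_def r_def)
  moreover have "primitive_on \<F> (\<lambda>t. \<delta> (2 * t - 1)) (1/2) 1 (\<lambda>t. q (2 * t - 1))"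
    by (rule primitive_on_reparametrize[OF q(1)]) (auto intro!: continuous_intros)
  then have "primitive_on \<F> (\<lambda>t. \<delta> (2 * t - 1)) (1/2) 1 (\<lambda>t. q (2 * t - 1) + (p 1 - q 0))"
    by (rule primitive_on_shift)
  then have "primitive_on \<F> (path_join \<gamma> \<delta>) (1/2) 1 r"
  proof (rule primitive_on_cong)
    fix t :: real assume "t \<in> {1/2..1}"
    then consider "t = 1/2" | "t > 1/2" by fastforce
    then show "\<delta> (2 * t - 1) = path_join \<gamma> \<delta> t \<and> q (2 * t - 1) + (p 1 - q 0) = r t"
    proof cases
      case 1
      then have "2 * t = 1" "2 * t - 1 = 0" by simp_all
      then show ?thesis using 1 assms(4) unfolding path_join_def r_def by (simp only:) simp
    qed (simp add: path_join_def r_def)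
  qed
  ultimately have "primitive_on \<F> (path_join \<gamma> \<delta>) 0 1 r"
    by (rule primitive_on_glue)
  from form_integral_eq_primitive_increment[OF \<omega> F pathin_path_join[OF assms(2-4)] this]
  show ?thesis using p(2) q(2) by (simp add: r_def)
qed

text \<open>
  Near a point of the parameter space and on a short time interval, the homotopy stays where a
  single function of the family varies by less than 2. Adding finitely many time intervals gives a
  local bound, and compactness of the parameter space a global one.
\<close>

lemma form_integral_bounded_on_compact_family:
  assumes \<omega>: "\<omega> \<in> closed_1_forms X" and K: "compact_space K"
    and H: "continuous_map (prod_topology (top_of_set {0..1::real}) K) X H"
  obtains B where "\<And>q. q \<in> topspace K \<Longrightarrow> \<bar>form_integral \<omega> (\<lambda>t. H (t, q))\<bar> \<le> B"
proof -
  obtain \<F> where F: "\<F> \<in> \<omega>" using closed_1_forms_members(1)[OF \<omega>] by blast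
  note cl = closed_1_forms_members(2)[OF \<omega> F]
  have path: "pathin X (\<lambda>t. H (t, q))" if "q \<in> topspace K" for q
  proof -
    have "continuous_map (top_of_set {0..1}) (prod_topology (top_of_set {0..1::real}) K) (\<lambda>t. (t, q))"
      using that by (intro continuous_map_pairedI) auto
    from continuous_map_compose[OF this H] show ?thesis by (simp add: pathin_def o_def)
  qed
  define bdd where "bdd N B a b \<longleftrightarrow>
      (\<forall>q\<in>N. \<forall>p. primitive_on \<F> (\<lambda>t. H (t, q)) 0 1 p \<longrightarrow> \<bar>p b - p a\<bar> \<le> B)" for N B a b
  have loc: "\<exists>N B. openin K N \<and> x \<in> N \<and> bdd N B 0 1" if x: "x \<in> topspace K" for x
  proof -
    show ?thesis
      using zero_le_one
    proof (rule Bolzano_subintervals[where P = "\<lambda>a b. \<exists>N B. openin K N \<and> x \<in> N \<and> bdd N B a b"])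
      fix a b c
      assume "\<exists>N B. openin K N \<and> x \<in> N \<and> bdd N B a b" "\<exists>N B. openin K N \<and> x \<in> N \<and> bdd N B b c"
      then obtain N B N' B' where 1: "openin K N" "x \<in> N" "bdd N B a b"
          and 2: "openin K N'" "x \<in> N'" "bdd N' B' b c" by blast
        have "bdd (N \<inter> N') (B + B') a c"
          unfolding bdd_def
        proof (intro ballI allI impI)
          fix q p assume "q \<in> N \<inter> N'" and p: "primitive_on \<F> (\<lambda>t. H (t, q)) 0 1 p"
          then have "\<bar>p b - p a\<bar> \<le> B" "\<bar>p c - p b\<bar> \<le> B'"
            using 1(3) 2(3) unfolding bdd_def by blast+
          then show "\<bar>p c - p a\<bar> \<le> B + B'" by linarith
        qed
        then show "\<exists>N B. openin K N \<and> x \<in> N \<and> bdd N B a c"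
          using openin_Int[OF 1(1) 2(1)] 1(2) 2(2) by blast
    next
      fix \<tau> :: real assume "\<tau> \<in> {0..1}"
      then have \<tau>: "(\<tau>, x) \<in> topspace (prod_topology (top_of_set {0..1::real}) K)" using x by simp
      then have "H (\<tau>, x) \<in> topspace X" using H by (auto simp: continuous_map_def)
      then obtain U f where U: "(U, f) \<in> \<F>" "H (\<tau>, x) \<in> U" using closed_form_familyD(3)[OF cl] by blast
      define V where "V = {y \<in> topspace (subtopology X U). f y \<in> {f (H (\<tau>, x)) - 1 <..< f (H (\<tau>, x)) + 1}}"
      have "openin (subtopology X U) V"
        unfolding V_def by (rule openin_continuous_map_preimage[OF closed_form_familyD(2)[OF cl U(1)]]) auto
      then have V: "openin X V"
        using closed_form_familyD(1)[OF cl U(1)] openin_trans_full by blast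
      have HV: "H (\<tau>, x) \<in> V" using U \<open>H (\<tau>, x) \<in> topspace X\<close> by (auto simp: V_def)
      let ?P = "{z \<in> topspace (prod_topology (top_of_set {0..1::real}) K). H z \<in> V}"
      have "openin (prod_topology (top_of_set {0..1::real}) K) ?P"
        by (rule openin_continuous_map_preimage[OF H V])
      then obtain J N where J: "openin (top_of_set {0..1::real}) J" "\<tau> \<in> J"
        and N: "openin K N" "x \<in> N" and JN: "J \<times> N \<subseteq> ?P"
        unfolding openin_prod_topology_alt using \<tau> HV by blast
      obtain e where e: "e > 0" "\<And>s. s \<in> {0..1} \<Longrightarrow> \<bar>s - \<tau>\<bar> < e \<Longrightarrow> s \<in> J"
        using J unfolding openin_euclidean_subtopology_iff dist_real_def by blast
      have "bdd N 2 a b" if ab: "0 \<le> a" "a \<le> \<tau>" "\<tau> \<le> b" "b \<le> 1" "b - a < e" for a b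
        unfolding bdd_def
      proof (intro ballI allI impI)
        fix q p assume q: "q \<in> N" and p: "primitive_on \<F> (\<lambda>t. H (t, q)) 0 1 p"
        have ab': "a \<le> b" "0 \<le> a" "b \<le> 1" using ab by auto
        have HV: "H (s, q) \<in> V" if "s \<in> {a..b}" for s
        proof -
          have "s \<in> J" using e(2)[of s] that ab ab' by auto
          then show ?thesis using JN q by auto
        qed
        then have "(\<lambda>t. H (t, q)) ` {a..b} \<subseteq> U" by (auto simp: V_def)
        from primitive_on_increment_in_member[OF p U(1) this] ab'
        have "p b - p a = f (H (b, q)) - f (H (a, q))" by simp
        with HV[of a] HV[of b] ab' show "\<bar>p b - p a\<bar> \<le> 2" by (auto simp: V_def)
      qed
      then show "\<exists>e>0. \<forall>a b. 0 \<le> a \<longrightarrow> a \<le> \<tau> \<longrightarrow> \<tau> \<le> b \<longrightarrow> b \<le> 1 \<longrightarrow> b - a < e \<longrightarrow>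
          (\<exists>N B. openin K N \<and> x \<in> N \<and> bdd N B a b)"
        using e(1) N by blast
    qed
  qed
  define \<U> where "\<U> = {N. openin K N \<and> (\<exists>B. bdd N B 0 1)}"
  have "topspace K \<subseteq> \<Union>\<U>" using loc unfolding \<U>_def by blast
  then obtain \<V> where V: "finite \<V>" "\<V> \<subseteq> \<U>" "topspace K \<subseteq> \<Union>\<V>"
    using K unfolding compact_space_alt by (metis (no_types, lifting) \<U>_def mem_Collect_eq)
  then have "\<forall>N\<in>\<V>. \<exists>B. bdd N B 0 1" unfolding \<U>_def by blast
  then obtain B where B: "\<And>N. N \<in> \<V> \<Longrightarrow> bdd N (B N) 0 1" by metis
  show thesis
  proof (rule that)
    fix q assume q: "q \<in> topspace K"
    then obtain N where N: "N \<in> \<V>" "q \<in> N" using V by blast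
    obtain p where p: "primitive_on \<F> (\<lambda>t. H (t, q)) 0 1 p" "form_integral \<omega> (\<lambda>t. H (t, q)) = p 1 - p 0"
      using obtain_primitive[OF \<omega> F path[OF q]] .
    then have "\<bar>form_integral \<omega> (\<lambda>t. H (t, q))\<bar> \<le> B N"
      using B[OF N(1)] N(2) unfolding bdd_def by auto
    also have "\<dots> \<le> (\<Sum>N\<in>\<V>. \<bar>B N\<bar>)"
      using member_le_sum[of N \<V> "\<lambda>N. \<bar>B N\<bar>"] V(1) N(1) by auto
    finally show "\<bar>form_integral \<omega> (\<lambda>t. H (t, q))\<bar> \<le> (\<Sum>N\<in>\<V>. \<bar>B N\<bar>)" .
  qed
qed

section \<open>Spaces covered by cones, and forms with equal periods\<close>

text \<open>
  The cone point is reached at time 0 and the base at time 1. The maps need not be embeddings. A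
  closed cell is the image of a disc, which is the cone over itself by radial contraction. The
  product of two such covers is again one, without identifying a product of discs with a disc.
\<close>

definition cone_cover ::
    "'i set \<Rightarrow> ('i \<Rightarrow> 'k topology) \<Rightarrow> ('i \<Rightarrow> real \<times> 'k \<Rightarrow> 'a) \<Rightarrow> 'a topology \<Rightarrow> bool" where
  "cone_cover I K H X \<longleftrightarrow> finite I \<and>
     (\<forall>i\<in>I. compact_space (K i) \<and>
        continuous_map (prod_topology (top_of_set {0..1}) (K i)) X (H i) \<and>
        (\<exists>c. \<forall>q\<in>topspace (K i). H i (0, q) = c)) \<and>
     topspace X = (\<Union>i\<in>I. (\<lambda>q. H i (1, q)) ` topspace (K i))"

lemma pathin_ray:
  assumes "continuous_map (prod_topology (top_of_set {0..1::real}) K) X H" "q \<in> topspace K"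
  shows "pathin X (\<lambda>t. H (t, q))"
proof -
  have "continuous_map (top_of_set {0..1}) (prod_topology (top_of_set {0..1::real}) K) (\<lambda>t. (t, q))"
    using assms(2) by (intro continuous_map_pairedI) auto
  from continuous_map_compose[OF this assms(1)] show ?thesis by (simp add: pathin_def o_def)
qed

lemma continuous_map_slice:
  assumes "continuous_map (prod_topology (top_of_set {0..1::real}) K) X H" "t \<in> {0..1}"
  shows "continuous_map K X (\<lambda>q. H (t, q))"
proof -
  have "continuous_map K (prod_topology (top_of_set {0..1::real}) K) (\<lambda>q. (t, q))"
    using assms(2) by (intro continuous_map_pairedI) auto
  from continuous_map_compose[OF this assms(1)] show ?thesis by (simp add: o_def)
qed

lemma cone_coverE:
  assumes "cone_cover I K H X" "i \<in> I"
  obtains c where "compact_space (K i)"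
    and "continuous_map (prod_topology (top_of_set {0..1::real}) (K i)) X (H i)"
    and "\<And>q. q \<in> topspace (K i) \<Longrightarrow> H i (0, q) = c"
proof -
  have "\<forall>i\<in>I. compact_space (K i) \<and>
        continuous_map (prod_topology (top_of_set {0..1::real}) (K i)) X (H i) \<and>
        (\<exists>c. \<forall>q\<in>topspace (K i). H i (0, q) = c)"
    using assms(1) unfolding cone_cover_def by (elim conjE)
  from bspec[OF this assms(2)] show thesis using that by blast
qed

lemma cone_cover_compactin:
  assumes "cone_cover I K H X" "i \<in> I"
  shows "compactin X ((\<lambda>q. H i (1, q)) ` topspace (K i))"
proof (rule image_compactin)
  have *: "compact_space (K i)" "continuous_map (prod_topology (top_of_set {0..1}) (K i)) X (H i)"
    using assms unfolding cone_cover_def by blast+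
  show "compactin (K i) (topspace (K i))" using *(1) by (simp only: compact_space_def)
  show "continuous_map (K i) X (\<lambda>q. H i (1, q))" using continuous_map_slice[OF *(2)] by simp
qed

lemma cone_cover_imp_compact_space:
  assumes "cone_cover I K H X"
  shows "compact_space X"
proof -
  have "compactin X (\<Union>i\<in>I. (\<lambda>q. H i (1, q)) ` topspace (K i))"
    using assms cone_cover_compactin[OF assms]
    by (intro compactin_Union) (auto simp: cone_cover_def)
  then show ?thesis using assms unfolding compact_space_def cone_cover_def by simp
qed

text \<open>
  The image of a base lies in one path component, since its points are joined to the cone point.
  So a path component is a union of finitely many compact sets, and so is its complement.
\<close>

lemma cone_cover_path_connected:
  assumes X: "cone_cover I K H X" and "Hausdorff_space X" and "connected_space X"
  shows "path_connected_space X"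
proof -
  define E where "E i = (\<lambda>q. H i (1, q)) ` topspace (K i)" for i
  have top: "topspace X = (\<Union>i\<in>I. E i)" and "finite I"
    using X unfolding cone_cover_def E_def by auto
  have cl: "closedin X (E i)" if "i \<in> I" for i
    using cone_cover_compactin[OF X that] compactin_imp_closedin[OF \<open>Hausdorff_space X\<close>]
    unfolding E_def by blast
  have pc: "path_component_of X y z" if i: "i \<in> I" and "y \<in> E i" "z \<in> E i" for i y z
  proof -
    obtain c where c: "\<And>q. q \<in> topspace (K i) \<Longrightarrow> H i (0, q) = c"
      and H: "continuous_map (prod_topology (top_of_set {0..1}) (K i)) X (H i)"
      using cone_coverE[OF X i] by blast
    have "path_component_of X c w" if w: "w \<in> E i" for w
    proof -
      obtain q where q: "q \<in> topspace (K i)" "w = H i (1, q)" using w unfolding E_def by blast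
      show ?thesis
        unfolding path_component_of_def
        using pathin_ray[OF H q(1)] c[OF q(1)] q(2) by (intro exI[of _ "\<lambda>t. H i (t, q)"]) simp
    qed
    with that show ?thesis by (meson path_component_of_sym path_component_of_trans)
  qed
  have "path_component_of_set X x = topspace X" if x: "x \<in> topspace X" for x
  proof -
    let ?S = "path_component_of_set X x"
    have S: "?S \<subseteq> topspace X" by (rule path_component_of_subset_topspace)
    have sat: "E i \<subseteq> ?S" if i: "i \<in> I" and ne: "E i \<inter> ?S \<noteq> {}" for i
    proof
      fix z assume z: "z \<in> E i"
      from ne obtain y where "y \<in> E i" "path_component_of X x y" by blast
      with pc[OF i _ z] show "z \<in> ?S" using path_component_of_trans by fastforce
    qed
    have "?S = \<Union>(E ` {i \<in> I. E i \<inter> ?S \<noteq> {}})"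
    proof
      show "?S \<subseteq> \<Union>(E ` {i \<in> I. E i \<inter> ?S \<noteq> {}})"
      proof
        fix y assume y: "y \<in> ?S"
        then obtain i where "i \<in> I" "y \<in> E i" using S unfolding top by blast
        with y show "y \<in> \<Union>(E ` {i \<in> I. E i \<inter> ?S \<noteq> {}})" by blast
      qed
      show "\<Union>(E ` {i \<in> I. E i \<inter> ?S \<noteq> {}}) \<subseteq> ?S"
        using sat by (intro Union_least) (elim imageE CollectE conjE, simp only:)
    qed
    moreover have "closedin X (\<Union>(E ` {i \<in> I. E i \<inter> ?S \<noteq> {}}))"
      using \<open>finite I\<close> cl by (intro closedin_Union) auto
    ultimately have "closedin X ?S" by (simp only:)
    have "topspace X - ?S = \<Union>(E ` {i \<in> I. E i \<inter> ?S = {}})"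
    proof
      show "topspace X - ?S \<subseteq> \<Union>(E ` {i \<in> I. E i \<inter> ?S = {}})"
      proof
        fix y assume y: "y \<in> topspace X - ?S"
        then obtain i where i: "i \<in> I" "y \<in> E i" unfolding top by blast
        with sat[OF i(1)] y have "E i \<inter> ?S = {}" by blast
        with i show "y \<in> \<Union>(E ` {i \<in> I. E i \<inter> ?S = {}})" by blast
      qed
      show "\<Union>(E ` {i \<in> I. E i \<inter> ?S = {}}) \<subseteq> topspace X - ?S"
        unfolding top by blast
    qed
    moreover have "closedin X (\<Union>(E ` {i \<in> I. E i \<inter> ?S = {}}))"
      using \<open>finite I\<close> cl by (intro closedin_Union) auto
    ultimately have "closedin X (topspace X - ?S)" by (simp only:)
    then have "openin X ?S" using S by (simp add: openin_closedin_eq)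
    with \<open>closedin X ?S\<close> have "?S = {} \<or> ?S = topspace X"
      using \<open>connected_space X\<close> unfolding connected_space_clopen_in by blast
    moreover have "x \<in> ?S" using x by (simp add: path_component_of_refl)
    ultimately show ?thesis by blast
  qed
  then show ?thesis
    unfolding path_connected_space_iff_path_component by blast
qed

text \<open>
  The difference of the two integrals depends only on the end points of a path, so it is the
  increment of a potential. Along the rays of a cone the potential changes by a bounded amount,
  because the cone is a compact family of paths; and there are finitely many cones.
\<close>

lemma same_periods_imp_integrals_boundedly_close:
  assumes X: "cone_cover I K H X"
    and \<omega>: "\<omega> \<in> closed_1_forms X" "\<omega>' \<in> closed_1_forms X"
    and per: "\<And>\<gamma>. pathin X \<gamma> \<Longrightarrow> \<gamma> 0 = \<gamma> 1 \<Longrightarrow> form_integral \<omega> \<gamma> = form_integral \<omega>' \<gamma>"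
  obtains B where "B \<ge> 0"
    and "\<And>\<gamma>. pathin X \<gamma> \<Longrightarrow> \<bar>form_integral \<omega> \<gamma> - form_integral \<omega>' \<gamma>\<bar> \<le> B"
proof -
  define D where "D \<gamma> = form_integral \<omega> \<gamma> - form_integral \<omega>' \<gamma>" for \<gamma>
  have D_join: "D (path_join \<gamma> \<delta>) = D \<gamma> + D \<delta>" if "pathin X \<gamma>" "pathin X \<delta>" "\<gamma> 1 = \<delta> 0" for \<gamma> \<delta>
    using form_integral_path_join[OF \<omega>(1) that] form_integral_path_join[OF \<omega>(2) that]
    by (simp add: D_def)
  have D_eq: "D \<gamma> = D \<delta>"
    if "pathin X \<gamma>" "pathin X \<delta>" "\<gamma> 0 = \<delta> 0" "\<gamma> 1 = \<delta> 1" for \<gamma> \<delta>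
  proof -
    let ?r = "\<lambda>t. \<delta> (1 - t)"
    have r: "pathin X ?r"
      by (rule pathin_reparametrize[OF that(2)]) (auto intro!: continuous_intros)
    have "pathin X (path_join \<gamma> ?r)" using pathin_path_join[OF that(1) r] that(4) by simp
    then have "D (path_join \<gamma> ?r) = 0"
      using per[of "path_join \<gamma> ?r"] that(3) by (simp add: D_def path_join_def)
    moreover have "D (path_join \<gamma> ?r) = D \<gamma> + D ?r" using D_join[OF that(1) r] that(4) by simp
    moreover have "D ?r = - D \<delta>"
      using form_integral_reverse[OF \<omega>(1) that(2)] form_integral_reverse[OF \<omega>(2) that(2)]
      by (simp add: D_def)
    ultimately show ?thesis by simp
  qed
  \<comment> \<open>A base point that depends only on the path component of \<open>x\<close>.\<close>
  define b where "b x = (SOME z. z \<in> path_component_of_set X x)" for x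
  define g where "g x = (SOME \<gamma>. pathin X \<gamma> \<and> \<gamma> 0 = b x \<and> \<gamma> 1 = x)" for x
  define f where "f x = D (g x)" for x
  have g: "pathin X (g x) \<and> g x 0 = b x \<and> g x 1 = x" if "x \<in> topspace X" for x
  proof -
    have "x \<in> path_component_of_set X x" using that by (simp add: path_component_of_refl)
    then have "b x \<in> path_component_of_set X x" unfolding b_def by (rule someI)
    then have "path_component_of X (b x) x" by (simp add: path_component_of_sym)
    then show ?thesis unfolding path_component_of_def g_def by (rule someI_ex)
  qed
  have D_f: "D \<gamma> = f (\<gamma> 1) - f (\<gamma> 0)" if \<gamma>: "pathin X \<gamma>" for \<gamma>
  proof -
    have pc: "path_component_of X (\<gamma> 0) (\<gamma> 1)" using \<gamma> unfolding path_component_of_def by blast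
    then have "path_component_of_set X (\<gamma> 0) = path_component_of_set X (\<gamma> 1)"
      by (simp add: path_component_of_equiv)
    then have bb: "b (\<gamma> 0) = b (\<gamma> 1)" unfolding b_def by (simp only:)
    have t: "\<gamma> 0 \<in> topspace X" "\<gamma> 1 \<in> topspace X"
      using pc path_component_in_topspace by fast+
    have "D (path_join (g (\<gamma> 0)) \<gamma>) = D (g (\<gamma> 1))"
      using g[OF t(1)] g[OF t(2)] bb \<gamma> by (intro D_eq pathin_path_join) (auto simp: path_join_def)
    moreover have "D (path_join (g (\<gamma> 0)) \<gamma>) = D (g (\<gamma> 0)) + D \<gamma>"
      using g[OF t(1)] \<gamma> by (intro D_join) auto
    ultimately show ?thesis by (simp add: f_def)
  qed
  have "\<exists>M. \<forall>q\<in>topspace (K i). \<bar>f (H i (1, q))\<bar> \<le> M" if i: "i \<in> I" for i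
  proof -
    obtain c where c: "\<And>q. q \<in> topspace (K i) \<Longrightarrow> H i (0, q) = c"
      and K: "compact_space (K i)"
      and H: "continuous_map (prod_topology (top_of_set {0..1}) (K i)) X (H i)"
      using cone_coverE[OF X i] by blast
    obtain B where B: "\<And>q. q \<in> topspace (K i) \<Longrightarrow> \<bar>form_integral \<omega> (\<lambda>t. H i (t, q))\<bar> \<le> B"
      using form_integral_bounded_on_compact_family[OF \<omega>(1) K H] by blast
    obtain B' where B': "\<And>q. q \<in> topspace (K i) \<Longrightarrow> \<bar>form_integral \<omega>' (\<lambda>t. H i (t, q))\<bar> \<le> B'"
      using form_integral_bounded_on_compact_family[OF \<omega>(2) K H] by blast
    have "\<bar>f (H i (1, q))\<bar> \<le> \<bar>f c\<bar> + B + B'" if q: "q \<in> topspace (K i)" for q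
      using D_f[OF pathin_ray[OF H q]] B[OF q] B'[OF q] c[OF q] unfolding D_def by simp
    then show ?thesis by blast
  qed
  then obtain M where M: "\<And>i q. i \<in> I \<Longrightarrow> q \<in> topspace (K i) \<Longrightarrow> \<bar>f (H i (1, q))\<bar> \<le> M i"
    by metis
  have f_bound: "\<bar>f x\<bar> \<le> (\<Sum>i\<in>I. \<bar>M i\<bar>)" if x: "x \<in> topspace X" for x
  proof -
    obtain i q where iq: "i \<in> I" "q \<in> topspace (K i)" "x = H i (1, q)"
      using x X unfolding cone_cover_def by auto
    then have "\<bar>f x\<bar> \<le> \<bar>M i\<bar>" using M[OF iq(1,2)] by simp
    also have "\<dots> \<le> (\<Sum>i\<in>I. \<bar>M i\<bar>)"
      using X iq(1) member_le_sum[of i I "\<lambda>i. \<bar>M i\<bar>"] unfolding cone_cover_def by auto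
    finally show ?thesis .
  qed
  show thesis
  proof (rule that)
    show "0 \<le> 2 * (\<Sum>i\<in>I. \<bar>M i\<bar>)" by (simp add: sum_nonneg)
    fix \<gamma> assume \<gamma>: "pathin X \<gamma>"
    then have "\<gamma> 0 \<in> topspace X" "\<gamma> 1 \<in> topspace X"
      unfolding pathin_def continuous_map_def by auto
    then show "\<bar>form_integral \<omega> \<gamma> - form_integral \<omega>' \<gamma>\<bar> \<le> 2 * (\<Sum>i\<in>I. \<bar>M i\<bar>)"
      using D_f[OF \<gamma>] f_bound[of "\<gamma> 0"] f_bound[of "\<gamma> 1"] unfolding D_def by linarith
  qed
qed

lemma cone_cover_prod:
  assumes X: "cone_cover I K H X" and Y: "cone_cover J L G Y"
  shows "cone_cover (I \<times> J) (\<lambda>(i, j). prod_topology (K i) (L j))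
           (\<lambda>(i, j) (t, p, q). (H i (t, p), G j (t, q))) (prod_topology X Y)"
  unfolding cone_cover_def
proof (intro conjI ballI)
  show "finite (I \<times> J)" using X Y by (simp add: cone_cover_def)
  show "topspace (prod_topology X Y) = (\<Union>ij\<in>I \<times> J. (\<lambda>q. (case ij of (i, j) \<Rightarrow> \<lambda>(t, p, q). (H i (t, p), G j (t, q))) (1, q)) `
      topspace (case ij of (i, j) \<Rightarrow> prod_topology (K i) (L j)))"
    using X Y unfolding cone_cover_def by (auto simp: image_iff) blast+
  fix ij assume "ij \<in> I \<times> J"
  then obtain i j where ij: "ij = (i, j)" "i \<in> I" "j \<in> J" by blast
  let ?I = "top_of_set {0..1::real}"
  obtain c where 1: "compact_space (K i)" "\<And>q. q \<in> topspace (K i) \<Longrightarrow> H i (0, q) = c"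
      and H: "continuous_map (prod_topology ?I (K i)) X (H i)"
    using cone_coverE[OF X ij(2)] by blast
  obtain d where 2: "compact_space (L j)" "\<And>q. q \<in> topspace (L j) \<Longrightarrow> G j (0, q) = d"
      and G: "continuous_map (prod_topology ?I (L j)) Y (G j)"
    using cone_coverE[OF Y ij(3)] by blast
  show "compact_space (case ij of (i, j) \<Rightarrow> prod_topology (K i) (L j))"
    using 1 2 by (simp add: ij compact_space_prod_topology)
  show "\<exists>c. \<forall>q\<in>topspace (case ij of (i, j) \<Rightarrow> prod_topology (K i) (L j)).
      (case ij of (i, j) \<Rightarrow> \<lambda>(t, p, q). (H i (t, p), G j (t, q))) (0, q) = c"
    using 1 2 by (intro exI[of _ "(c, d)"]) (auto simp: ij)
  let ?P = "prod_topology ?I (prod_topology (K i) (L j))"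
  have "continuous_map ?P (prod_topology ?I (K i)) (\<lambda>z. (fst z, fst (snd z)))"
    "continuous_map ?P (prod_topology ?I (L j)) (\<lambda>z. (fst z, snd (snd z)))"
    by (intro continuous_map_pairedI continuous_map_fst continuous_map_fst_of continuous_map_snd_of
        continuous_map_snd[unfolded o_def] continuous_map_compose[unfolded o_def, OF continuous_map_snd]
        continuous_map_fst continuous_map_snd)+
  from continuous_map_compose[OF this(1) H] continuous_map_compose[OF this(2) G]
  have "continuous_map ?P (prod_topology X Y) (\<lambda>z. (H i (fst z, fst (snd z)), G j (fst z, snd (snd z))))"
    by (intro continuous_map_pairedI) (simp_all add: o_def)
  then show "continuous_map (prod_topology ?I (case ij of (i, j) \<Rightarrow> prod_topology (K i) (L j)))
      (prod_topology X Y) (case ij of (i, j) \<Rightarrow> \<lambda>(t, p, q). (H i (t, p), G j (t, q)))"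
    by (simp add: ij case_prod_unfold)
qed

lemma compact_space_cell_disc: "compact_space (cell_disc n)"
proof -
  let ?T = "powertop_real (UNIV :: nat set)"
  let ?D = "{x \<in> topspace (Euclidean_space n). (\<Sum>i<n. (x i)\<^sup>2) \<in> {..1}}"
  have coord: "continuous_map ?T euclideanreal (\<lambda>x. x i)" for i
    using continuous_map_product_coordinates[of i UNIV "\<lambda>_. euclideanreal"] by simp
  then have "continuous_map (Euclidean_space n) euclideanreal (\<lambda>x. x i)" for i
    unfolding Euclidean_space_def by (rule continuous_map_from_subtopology)
  then have "continuous_map (Euclidean_space n) euclideanreal (\<lambda>x. \<Sum>i<n. (x i)\<^sup>2)"
    by (intro continuous_intros) auto
  then have "closedin (Euclidean_space n) ?D"
    by (rule closedin_continuous_map_preimage) simp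
  then have cl: "closedin ?T ?D"
    unfolding closedin_Euclidean_space_iff by (simp add: euclidean_product_topology flip: closed_closedin)
  have comp: "compactin ?T (\<Pi>\<^sub>E i\<in>UNIV. {-1..1})"
    by (simp add: compactin_PiE compactin_euclidean_iff)
  have sub: "?D \<subseteq> (\<Pi>\<^sub>E i\<in>UNIV. {-1..1})"
  proof
    fix x assume x: "x \<in> ?D"
    have "\<bar>x i\<bar> \<le> 1" for i
    proof (cases "i < n")
      case True
      then have "(x i)\<^sup>2 \<le> (\<Sum>i<n. (x i)\<^sup>2)" by (intro member_le_sum) auto
      also have "\<dots> \<le> 1" using x by simp
      finally show ?thesis by (simp add: abs_square_le_1)
    next
      case False
      with x show ?thesis by (simp add: topspace_Euclidean_space)
    qed
    then show "x \<in> (\<Pi>\<^sub>E i\<in>UNIV. {-1..1})" by (auto simp: PiE_UNIV_domain abs_le_iff minus_le_iff)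
  qed
  have "compactin ?T ?D" using closed_compactin[OF comp sub cl] .
  then have "compactin (Euclidean_space n) ?D"
    unfolding Euclidean_space_def by (auto simp: compactin_subtopology)
  moreover have "cell_disc n = subtopology (Euclidean_space n) ?D"
  proof -
    have "?D = topspace (Euclidean_space n) \<inter> {x. (\<Sum>i<n. (x i)\<^sup>2) \<le> 1}" by auto
    then show ?thesis
      using subtopology_restrict[of "Euclidean_space n" "{x. (\<Sum>i<n. (x i)\<^sup>2) \<le> 1}"]
      by (simp only: cell_disc_def)
  qed
  ultimately show ?thesis by (simp add: compact_space_subtopology)
qed

text \<open>
  The cones are the characteristic maps precomposed with scalar multiplication on the disc.
\<close>

lemma finite_cell_complex_cone_cover:
  fixes X :: "'a topology"
  assumes "finite_cell_complex X"
  obtains m :: nat and K :: "nat \<Rightarrow> (nat \<Rightarrow> real) topology" and H where "cone_cover {..<m} K H X"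
proof -
  obtain m :: nat and d :: "nat \<Rightarrow> nat" and \<Phi> :: "nat \<Rightarrow> (nat \<Rightarrow> real) \<Rightarrow> 'a" where
    cells: "(\<forall>i<m. continuous_map (cell_disc (d i)) X (\<Phi> i) \<and>
               inj_on (\<Phi> i) (cell_interior (d i)) \<and>
               \<Phi> i ` cell_boundary (d i) \<subseteq> (\<Union>j\<in>{j. j < m \<and> d j < d i}. \<Phi> j ` cell_interior (d j))) \<and>
        (\<forall>i<m. \<forall>j<m. i \<noteq> j \<longrightarrow> \<Phi> i ` cell_interior (d i) \<inter> \<Phi> j ` cell_interior (d j) = {}) \<and>
        topspace X = (\<Union>i<m. \<Phi> i ` cell_interior (d i))"
    using conjunct2[OF assms[unfolded finite_cell_complex_def]] by (elim exE) (erule that)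
  note all = conjunct1[OF cells] and top = conjunct2[OF conjunct2[OF cells]]
  have cont: "continuous_map (cell_disc (d i)) X (\<Phi> i)" if "i < m" for i
    using all that by simp
  let ?I = "top_of_set {0..1::real}"
  have scale: "continuous_map (prod_topology ?I (cell_disc n)) (cell_disc n) (\<lambda>z i. fst z * snd z i)" for n
  proof -
    have coord: "continuous_map (cell_disc n) euclideanreal (\<lambda>x. x i)" for i
    proof -
      have "continuous_map (powertop_real UNIV) euclideanreal (\<lambda>x. x i)"
        using continuous_map_product_coordinates[of i UNIV "\<lambda>_. euclideanreal"] by simp
      then show ?thesis
        unfolding cell_disc_def Euclidean_space_def by (intro continuous_map_from_subtopology)
    qed
    have "continuous_map (prod_topology ?I (cell_disc n)) euclideanreal (\<lambda>z. fst z * snd z i)" for i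
    proof (intro continuous_map_real_mult)
      show "continuous_map (prod_topology ?I (cell_disc n)) euclideanreal fst"
        by (rule continuous_map_into_fulltopology[OF continuous_map_fst])
      show "continuous_map (prod_topology ?I (cell_disc n)) euclideanreal (\<lambda>z. snd z i)"
        using continuous_map_compose[OF continuous_map_snd coord] by (simp add: o_def)
    qed
    moreover have "(\<Sum>i<n. (s * x i)\<^sup>2) \<le> 1"
      if "0 \<le> s" "s \<le> 1" "(\<Sum>i<n. (x i)\<^sup>2) \<le> 1" for s :: real and x
    proof -
      have "(s * x i)\<^sup>2 \<le> (x i)\<^sup>2" for i
        using that by (simp add: power_mult_distrib mult_left_le_one_le power_le_one)
      then have "(\<Sum>i<n. (s * x i)\<^sup>2) \<le> (\<Sum>i<n. (x i)\<^sup>2)" by (intro sum_mono)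
      with that show ?thesis by simp
    qed
    ultimately show ?thesis
      unfolding cell_disc_def Euclidean_space_def
      by (auto simp: continuous_map_in_subtopology continuous_map_componentwise_UNIV)
  qed
  define H where "H i z = \<Phi> i (\<lambda>j. fst z * snd z j)" for i and z :: "real \<times> (nat \<Rightarrow> real)"
  have "cone_cover {..<m} (\<lambda>i. cell_disc (d i)) H X"
    unfolding cone_cover_def
  proof (intro conjI ballI)
    fix i assume "i \<in> {..<m}"
    moreover have "H i = \<Phi> i \<circ> (\<lambda>z j. fst z * snd z j)" by (simp add: H_def fun_eq_iff)
    ultimately show "continuous_map (prod_topology ?I (cell_disc (d i))) X (H i)"
      using continuous_map_compose[OF scale cont] by simp
    show "\<exists>c. \<forall>q\<in>topspace (cell_disc (d i)). H i (0, q) = c" by (simp add: H_def)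
  next
    have H1: "H i (1, q) = \<Phi> i q" for i q by (simp add: H_def)
    show "topspace X = (\<Union>i\<in>{..<m}. (\<lambda>q. H i (1, q)) ` topspace (cell_disc (d i)))"
      unfolding H1
    proof
      show "topspace X \<subseteq> (\<Union>i\<in>{..<m}. \<Phi> i ` topspace (cell_disc (d i)))"
        unfolding top cell_interior_def by blast
      show "(\<Union>i\<in>{..<m}. \<Phi> i ` topspace (cell_disc (d i))) \<subseteq> topspace X"
        using cont unfolding continuous_map_def by blast
    qed
  qed (simp_all add: compact_space_cell_disc)
  then show ?thesis using that by blast
qed

section \<open>The sum of two closed 1-forms on a product\<close>

definition product_family :: "'a form_family \<Rightarrow> 'b form_family \<Rightarrow> ('a \<times> 'b) form_family" where
  "product_family \<F> \<G> = (\<lambda>((U, f), (V, g)). (U \<times> V, \<lambda>z. f (fst z) + g (snd z))) ` (\<F> \<times> \<G>)"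

lemma product_familyE:
  assumes "(W, w) \<in> product_family \<F> \<G>"
  obtains U f V g where "(U, f) \<in> \<F>" "(V, g) \<in> \<G>" "W = U \<times> V" "w = (\<lambda>z. f (fst z) + g (snd z))"
  using assms unfolding product_family_def by auto

lemma closed_form_family_product:
  assumes F: "closed_form_family X \<F>" and G: "closed_form_family Y \<G>"
  shows "closed_form_family (prod_topology X Y) (product_family \<F> \<G>)"
proof (rule closed_form_familyI)
  fix W w assume "(W, w) \<in> product_family \<F> \<G>"
  then obtain U f V g where U: "(U, f) \<in> \<F>" and V: "(V, g) \<in> \<G>" and W: "W = U \<times> V"
    and w: "w = (\<lambda>z. f (fst z) + g (snd z))" by (rule product_familyE)
  show "openin (prod_topology X Y) W"
    using closed_form_familyD(1)[OF F U] closed_form_familyD(1)[OF G V]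
    by (simp add: W openin_prod_Times_iff)
  let ?S = "prod_topology (subtopology X U) (subtopology Y V)"
  have "continuous_map ?S euclideanreal w"
    unfolding w
    using continuous_map_compose[OF continuous_map_fst closed_form_familyD(2)[OF F U], of "subtopology Y V"]
      continuous_map_compose[OF continuous_map_snd closed_form_familyD(2)[OF G V], of "subtopology X U"]
    by (intro continuous_map_add) (simp_all add: o_def)
  then show "continuous_map (subtopology (prod_topology X Y) W) euclideanreal w"
    by (simp add: W subtopology_Times)
next
  fix z assume "z \<in> topspace (prod_topology X Y)"
  then have z: "fst z \<in> topspace X" "snd z \<in> topspace Y" by auto
  obtain U f where U: "(U, f) \<in> \<F>" "fst z \<in> U" using closed_form_familyD(3)[OF F z(1)] by blast
  obtain V g where V: "(V, g) \<in> \<G>" "snd z \<in> V" using closed_form_familyD(3)[OF G z(2)] by blast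
  have "(U \<times> V, \<lambda>z. f (fst z) + g (snd z)) \<in> product_family \<F> \<G>"
    using U V unfolding product_family_def by force
  moreover have "z \<in> U \<times> V" using U V by (simp add: mem_Times_iff)
  ultimately show "\<exists>W w. (W, w) \<in> product_family \<F> \<G> \<and> z \<in> W" by blast
next
  fix W w W' w' z
  assume "(W, w) \<in> product_family \<F> \<G>" "(W', w') \<in> product_family \<F> \<G>" and z: "z \<in> W" "z \<in> W'"
  then obtain U f V g U' f' V' g'
    where U: "(U, f) \<in> \<F>" and V: "(V, g) \<in> \<G>" and W: "W = U \<times> V"
    and w: "w = (\<lambda>z. f (fst z) + g (snd z))"
    and U': "(U', f') \<in> \<F>" and V': "(V', g') \<in> \<G>" and W': "W' = U' \<times> V'"
    and w': "w' = (\<lambda>z. f' (fst z) + g' (snd z))" by (elim product_familyE)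
  obtain A where A: "openin X A" "fst z \<in> A" "A \<subseteq> U \<inter> U'"
    "\<forall>y\<in>A. f y - f' y = f (fst z) - f' (fst z)"
    using closed_form_familyD(4)[OF F U U', of "fst z"] z unfolding W W' by (auto simp only: mem_Times_iff)
  obtain B where B: "openin Y B" "snd z \<in> B" "B \<subseteq> V \<inter> V'"
    "\<forall>y\<in>B. g y - g' y = g (snd z) - g' (snd z)"
    using closed_form_familyD(4)[OF G V V', of "snd z"] z unfolding W W' by (auto simp only: mem_Times_iff)
  have "w y - w' y = w z - w' z" if "y \<in> A \<times> B" for y
    using bspec[OF A(4), of "fst y"] bspec[OF B(4), of "snd y"] that
    unfolding w w' mem_Times_iff by linarith
  moreover have "openin (prod_topology X Y) (A \<times> B)" using A B by (simp add: openin_prod_Times_iff)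
  moreover have "z \<in> A \<times> B" "A \<times> B \<subseteq> W \<inter> W'" using A B unfolding W W' by (auto simp: mem_Times_iff)
  ultimately show "\<exists>A. openin (prod_topology X Y) A \<and> z \<in> A \<and> A \<subseteq> W \<inter> W' \<and> (\<forall>y\<in>A. w y - w' y = w z - w' z)"
    by blast
qed

lemma primitive_on_product:
  assumes p: "primitive_on \<F> (\<lambda>t. fst (\<gamma> t)) a b p" and q: "primitive_on \<G> (\<lambda>t. snd (\<gamma> t)) a b q"
  shows "primitive_on (product_family \<F> \<G>) \<gamma> a b (\<lambda>t. p t + q t)"
  unfolding primitive_on_def
proof clarify
  fix t W w assume t: "t \<in> {a..b}" and "(W, w) \<in> product_family \<F> \<G>" and "\<gamma> t \<in> W"
  then obtain U f V g where U: "(U, f) \<in> \<F>" "fst (\<gamma> t) \<in> U" and V: "(V, g) \<in> \<G>" "snd (\<gamma> t) \<in> V"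
    and w: "w = (\<lambda>z. f (fst z) + g (snd z))" by (auto elim!: product_familyE)
  obtain d where d: "d > 0"
      "\<And>s. s \<in> {a..b} \<Longrightarrow> \<bar>s - t\<bar> < d \<Longrightarrow> p s - f (fst (\<gamma> s)) = p t - f (fst (\<gamma> t))"
    using primitive_onD[OF p t U] by blast
  obtain e where e: "e > 0"
      "\<And>s. s \<in> {a..b} \<Longrightarrow> \<bar>s - t\<bar> < e \<Longrightarrow> q s - g (snd (\<gamma> s)) = q t - g (snd (\<gamma> t))"
    using primitive_onD[OF q t V] by blast
  have "p s + q s - w (\<gamma> s) = p t + q t - w (\<gamma> t)" if "s \<in> {a..b}" "\<bar>s - t\<bar> < min d e" for s
    using d(2)[of s] e(2)[of s] that unfolding w by simp
  moreover have "min d e > 0" using d(1) e(1) by simp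
  ultimately show "\<exists>e>0. \<forall>s\<in>{a..b}. \<bar>s - t\<bar> < e \<longrightarrow> p s + q s - w (\<gamma> s) = p t + q t - w (\<gamma> t)"
    by blast
qed

text \<open>
  The sum of a primitive along the first coordinate and a primitive along the second is a
  primitive along the path for the sum of the pulled-back forms.
\<close>

lemma obtain_product_form:
  assumes \<omega>: "\<omega>\<^sub>X \<in> closed_1_forms X" "\<omega>\<^sub>Y \<in> closed_1_forms Y"
  obtains \<omega> where "\<omega> \<in> closed_1_forms (prod_topology X Y)"
    and "\<And>\<gamma>. pathin (prod_topology X Y) \<gamma> \<Longrightarrow> form_integral \<omega> \<gamma> =
           form_integral \<omega>\<^sub>X (\<lambda>t. fst (\<gamma> t)) + form_integral \<omega>\<^sub>Y (\<lambda>t. snd (\<gamma> t))"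
proof -
  obtain \<F> where F: "\<F> \<in> \<omega>\<^sub>X" using closed_1_forms_members(1)[OF \<omega>(1)] by blast
  obtain \<G> where G: "\<G> \<in> \<omega>\<^sub>Y" using closed_1_forms_members(1)[OF \<omega>(2)] by blast
  let ?P = "prod_topology X Y"
  define \<omega> where "\<omega> = same_form ?P `` {product_family \<F> \<G>}"
  have cl: "closed_form_family ?P (product_family \<F> \<G>)"
    using closed_form_family_product closed_1_forms_members(2)[OF \<omega>(1) F]
      closed_1_forms_members(2)[OF \<omega>(2) G] by blast
  have \<omega>cl: "\<omega> \<in> closed_1_forms ?P"
    unfolding \<omega>_def closed_1_forms_def using cl by (intro quotientI) simp
  have mem: "product_family \<F> \<G> \<in> \<omega>"
    unfolding \<omega>_def same_form_def using cl by simp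
  show thesis
  proof (rule that[OF \<omega>cl])
    fix \<gamma> assume \<gamma>: "pathin ?P \<gamma>"
    have X: "pathin X (\<lambda>t. fst (\<gamma> t))" and Y: "pathin Y (\<lambda>t. snd (\<gamma> t))"
      using pathin_compose[OF \<gamma> continuous_map_fst] pathin_compose[OF \<gamma> continuous_map_snd]
      by (simp_all add: o_def)
    obtain p where p: "primitive_on \<F> (\<lambda>t. fst (\<gamma> t)) 0 1 p"
        "form_integral \<omega>\<^sub>X (\<lambda>t. fst (\<gamma> t)) = p 1 - p 0"
      using obtain_primitive[OF \<omega>(1) F X] .
    obtain q where q: "primitive_on \<G> (\<lambda>t. snd (\<gamma> t)) 0 1 q"
        "form_integral \<omega>\<^sub>Y (\<lambda>t. snd (\<gamma> t)) = q 1 - q 0"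
      using obtain_primitive[OF \<omega>(2) G Y] .
    show "form_integral \<omega> \<gamma> = form_integral \<omega>\<^sub>X (\<lambda>t. fst (\<gamma> t)) + form_integral \<omega>\<^sub>Y (\<lambda>t. snd (\<gamma> t))"
      using form_integral_eq_primitive_increment[OF \<omega>cl mem \<gamma> primitive_on_product[OF p(1) q(1)]] p(2) q(2)
      by simp
  qed
qed

section \<open>Singular cohomology classes and their cross products\<close>

lemma coboundary_add: "coboundary p (\<lambda>\<sigma>. \<phi> \<sigma> + \<psi> \<sigma>) \<sigma> = coboundary p \<phi> \<sigma> + coboundary p \<psi> \<sigma>"
  by (simp add: coboundary_def algebra_simps sum.distrib)

lemma coboundary_minus: "coboundary p (\<lambda>\<sigma>. - \<phi> \<sigma>) \<sigma> = - coboundary p \<phi> \<sigma>"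
  by (simp add: coboundary_def sum_negf)

lemma coboundary_cong:
  assumes "singular_simplex (Suc p) X \<sigma>"
    and "\<And>\<tau>. singular_simplex p X \<tau> \<Longrightarrow> \<phi> \<tau> = \<psi> \<tau>"
  shows "coboundary p \<phi> \<sigma> = coboundary p \<psi> \<sigma>"
  unfolding coboundary_def
proof (rule sum.cong)
  fix k assume "k \<in> {..Suc p}"
  then have "singular_simplex p X (singular_face (Suc p) k \<sigma>)"
    using singular_simplex_singular_face[OF assms(1), of k] by simp
  then show "(- 1) ^ k * \<phi> (singular_face (Suc p) k \<sigma>) = (- 1) ^ k * \<psi> (singular_face (Suc p) k \<sigma>)"
    using assms(2) by simp
qed simp

lemma coboundary_simplex_map:
  "coboundary p (\<lambda>\<sigma>. \<phi> (simplex_map p f \<sigma>)) \<sigma> = coboundary p \<phi> (simplex_map (Suc p) f \<sigma>)"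
  unfolding coboundary_def
proof (rule sum.cong)
  fix k assume "k \<in> {..Suc p}"
  then have "singular_face (Suc p) k (simplex_map (Suc p) f \<sigma>) = simplex_map p f (\<sigma> \<circ> simplical_face k)"
    using singular_face_simplex_map[of "Suc p" k f \<sigma>] by simp
  moreover have "simplex_map p f (singular_face (Suc p) k \<sigma>) = simplex_map p f (\<sigma> \<circ> simplical_face k)"
    unfolding simplex_map_def singular_face_def by (rule restrict_ext) simp
  ultimately show "(- 1) ^ k * \<phi> (simplex_map p f (singular_face (Suc p) k \<sigma>)) =
      (- 1) ^ k * \<phi> (singular_face (Suc p) k (simplex_map (Suc p) f \<sigma>))"
    by simp
qed simp

lemma cohomologousI:
  assumes "\<phi> \<in> cocycles p X" "\<psi> \<in> cocycles p X"
    and "\<And>\<sigma>. singular_simplex p X \<sigma> \<Longrightarrow> \<phi> \<sigma> - \<psi> \<sigma> = (if p = 0 then 0 else coboundary (p - 1) \<eta> \<sigma>)"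
  shows "(\<phi>, \<psi>) \<in> cohomologous p X"
  using assms unfolding cohomologous_def by blast

lemma cohomologousE:
  assumes "(\<phi>, \<psi>) \<in> cohomologous p X"
  obtains \<eta> where "\<phi> \<in> cocycles p X" "\<psi> \<in> cocycles p X"
    and "\<And>\<sigma>. singular_simplex p X \<sigma> \<Longrightarrow> \<phi> \<sigma> - \<psi> \<sigma> = (if p = 0 then 0 else coboundary (p - 1) \<eta> \<sigma>)"
  using assms unfolding cohomologous_def by blast

lemma cohomologous_if_equal_on_simplices:
  assumes "\<phi> \<in> cocycles p X" and eq: "\<And>\<sigma>. singular_simplex p X \<sigma> \<Longrightarrow> \<phi> \<sigma> = \<psi> \<sigma>"
  shows "(\<phi>, \<psi>) \<in> cohomologous p X"
proof (rule cohomologousI[where \<eta> = "\<lambda>_. 0"])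
  show "\<psi> \<in> cocycles p X"
    using assms(1) coboundary_cong[of p X _ \<phi> \<psi>] eq unfolding cocycles_def by fastforce
  show "\<phi> \<sigma> - \<psi> \<sigma> = (if p = 0 then 0 else coboundary (p - 1) (\<lambda>_. 0) \<sigma>)" if "singular_simplex p X \<sigma>" for \<sigma>
    using eq[OF that] by (simp add: coboundary_def)
qed (rule assms(1))

lemma equiv_cohomologous: "equiv (cocycles p X) (cohomologous p X)"
proof (rule equivI)
  show "cohomologous p X \<subseteq> cocycles p X \<times> cocycles p X"
    unfolding cohomologous_def by blast
  show "refl_on (cocycles p X) (cohomologous p X)"
    by (rule refl_onI) (auto intro: cohomologous_if_equal_on_simplices)
  show "sym (cohomologous p X)"
  proof (rule symI)
    fix \<phi> \<psi> assume "(\<phi>, \<psi>) \<in> cohomologous p X"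
    then obtain \<eta> where \<eta>: "\<phi> \<in> cocycles p X" "\<psi> \<in> cocycles p X"
      "\<And>\<sigma>. singular_simplex p X \<sigma> \<Longrightarrow> \<phi> \<sigma> - \<psi> \<sigma> = (if p = 0 then 0 else coboundary (p - 1) \<eta> \<sigma>)"
      by (rule cohomologousE) blast
    have "\<psi> \<sigma> - \<phi> \<sigma> = (if p = 0 then 0 else coboundary (p - 1) (\<lambda>\<sigma>. - \<eta> \<sigma>) \<sigma>)"
      if "singular_simplex p X \<sigma>" for \<sigma>
      using \<eta>(3)[OF that] by (simp add: coboundary_minus split: if_splits)
    with \<eta> show "(\<psi>, \<phi>) \<in> cohomologous p X" by (intro cohomologousI) blast+
  qed
  show "trans (cohomologous p X)"
  proof (rule transI)
    fix \<phi> \<psi> \<kappa> assume "(\<phi>, \<psi>) \<in> cohomologous p X" "(\<psi>, \<kappa>) \<in> cohomologous p X"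
    then obtain \<eta> \<theta> where \<eta>: "\<phi> \<in> cocycles p X"
      "\<And>\<sigma>. singular_simplex p X \<sigma> \<Longrightarrow> \<phi> \<sigma> - \<psi> \<sigma> = (if p = 0 then 0 else coboundary (p - 1) \<eta> \<sigma>)"
      and \<theta>: "\<kappa> \<in> cocycles p X"
      "\<And>\<sigma>. singular_simplex p X \<sigma> \<Longrightarrow> \<psi> \<sigma> - \<kappa> \<sigma> = (if p = 0 then 0 else coboundary (p - 1) \<theta> \<sigma>)"
      by (elim cohomologousE) blast
    have "\<phi> \<sigma> - \<kappa> \<sigma> = (if p = 0 then 0 else coboundary (p - 1) (\<lambda>\<sigma>. \<eta> \<sigma> + \<theta> \<sigma>) \<sigma>)"
      if "singular_simplex p X \<sigma>" for \<sigma>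
      using \<eta>(2)[OF that] \<theta>(2)[OF that] by (simp add: coboundary_add split: if_splits)
    with \<eta> \<theta> show "(\<phi>, \<kappa>) \<in> cohomologous p X" by (intro cohomologousI) blast+
  qed
qed

lemma cohomology_class:
  assumes "a \<in> cohomology p X" "\<phi> \<in> a"
  shows "a = cohomologous p X `` {\<phi>}" and "\<phi> \<in> cocycles p X"
proof -
  obtain \<psi> where \<psi>: "\<psi> \<in> cocycles p X" "a = cohomologous p X `` {\<psi>}"
    using assms(1) unfolding cohomology_def by (rule quotientE)
  then have rel: "(\<psi>, \<phi>) \<in> cohomologous p X" using assms(2) by simp
  show "a = cohomologous p X `` {\<phi>}"
    using equiv_class_eq[OF equiv_cohomologous rel] \<psi>(2) by simp
  show "\<phi> \<in> cocycles p X" using rel by (rule cohomologousE)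
qed

lemma cohomology_representative:
  assumes "a \<in> cohomology p X"
  obtains \<phi> where "\<phi> \<in> a" "\<phi> \<in> cocycles p X"
proof -
  have "a \<noteq> {}"
    using assms in_quotient_imp_non_empty[OF equiv_cohomologous] unfolding cohomology_def by blast
  then show ?thesis using that cohomology_class(2)[OF assms] by blast
qed

text \<open>
  Operations on classes are unions over all representatives; such a union collapses once its
  value is the same for each representative.
\<close>

lemma cohomology_UN_const:
  assumes "a \<in> cohomology p X" "\<And>\<phi>. \<phi> \<in> a \<Longrightarrow> F \<phi> = c"
  shows "(\<Union>\<phi>\<in>a. F \<phi>) = c"
proof -
  obtain \<phi> where "\<phi> \<in> a" by (rule cohomology_representative[OF assms(1)])
  then show ?thesis using assms(2) by blast
qed

lemma cohomology_classI: "\<phi> \<in> cocycles p X \<Longrightarrow> cohomologous p X `` {\<phi>} \<in> cohomology p X"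
  unfolding cohomology_def by (rule quotientI)

lemma cohomology_class_self: "\<phi> \<in> cocycles p X \<Longrightarrow> \<phi> \<in> cohomologous p X `` {\<phi>}"
  using equiv_class_self[OF equiv_cohomologous] .

lemma cohomology_pullback_class:
  assumes b: "b \<in> cohomology p Y" and \<phi>: "\<phi> \<in> b" and f: "continuous_map X Y f"
  shows "(\<lambda>\<sigma>. \<phi> (simplex_map p f \<sigma>)) \<in> cocycles p X"
    and "cohomology_pullback p X f b = cohomologous p X `` {\<lambda>\<sigma>. \<phi> (simplex_map p f \<sigma>)}"
proof -
  have cocycle: "(\<lambda>\<sigma>. \<psi> (simplex_map p f \<sigma>)) \<in> cocycles p X" if "\<psi> \<in> cocycles p Y" for \<psi>
    using that singular_simplex_simplex_map[OF _ f]
    unfolding cocycles_def by (simp add: coboundary_simplex_map)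
  show 1: "(\<lambda>\<sigma>. \<phi> (simplex_map p f \<sigma>)) \<in> cocycles p X"
    using cocycle cohomology_class(2)[OF b \<phi>] by blast
  show "cohomology_pullback p X f b = cohomologous p X `` {\<lambda>\<sigma>. \<phi> (simplex_map p f \<sigma>)}"
    unfolding cohomology_pullback_def
  proof (rule cohomology_UN_const[OF b])
    fix \<psi> assume "\<psi> \<in> b"
    then have "(\<phi>, \<psi>) \<in> cohomologous p Y" using cohomology_class(1)[OF b \<phi>] by blast
    then obtain \<eta> where \<psi>: "\<psi> \<in> cocycles p Y" and \<eta>:
      "\<And>\<sigma>. singular_simplex p Y \<sigma> \<Longrightarrow> \<phi> \<sigma> - \<psi> \<sigma> = (if p = 0 then 0 else coboundary (p - 1) \<eta> \<sigma>)"
      by (rule cohomologousE) blast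
    have "((\<lambda>\<sigma>. \<phi> (simplex_map p f \<sigma>)), (\<lambda>\<sigma>. \<psi> (simplex_map p f \<sigma>))) \<in> cohomologous p X"
    proof (rule cohomologousI[OF 1 cocycle[OF \<psi>]])
      fix \<sigma> assume "singular_simplex p X \<sigma>"
      then have "\<phi> (simplex_map p f \<sigma>) - \<psi> (simplex_map p f \<sigma>) =
          (if p = 0 then 0 else coboundary (p - 1) \<eta> (simplex_map p f \<sigma>))"
        using \<eta> singular_simplex_simplex_map[OF _ f] by blast
      also have "\<dots> = (if p = 0 then 0 else coboundary (p - 1) (\<lambda>\<sigma>. \<eta> (simplex_map (p - 1) f \<sigma>)) \<sigma>)"
        by (cases p) (simp_all add: coboundary_simplex_map)
      finally show "\<phi> (simplex_map p f \<sigma>) - \<psi> (simplex_map p f \<sigma>) =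
          (if p = 0 then 0 else coboundary (p - 1) (\<lambda>\<sigma>. \<eta> (simplex_map (p - 1) f \<sigma>)) \<sigma>)" .
    qed
    then show "cohomologous p X `` {\<lambda>\<sigma>. \<psi> (simplex_map p f \<sigma>)} = cohomologous p X `` {\<lambda>\<sigma>. \<phi> (simplex_map p f \<sigma>)}"
      using equiv_class_eq[OF equiv_cohomologous] by (metis (no_types, lifting))
  qed
qed

lemma one_cocycle: "(\<lambda>_. 1) \<in> cocycles 0 X"
  by (simp add: cocycles_def coboundary_def)

lemma cohomology_one_in_cohomology: "cohomology_one X \<in> cohomology 0 X"
  unfolding cohomology_one_def by (rule cohomology_classI[OF one_cocycle])

lemma cohomology_one_value:
  assumes "\<phi> \<in> cohomology_one X" "singular_simplex 0 X \<sigma>"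
  shows "\<phi> \<sigma> = 1"
proof -
  have "((\<lambda>_. 1), \<phi>) \<in> cohomologous 0 X" using assms(1) unfolding cohomology_one_def by simp
  then show ?thesis
  proof (rule cohomologousE)
    fix \<eta>
    assume "\<And>\<sigma>. singular_simplex 0 X \<sigma> \<Longrightarrow> 1 - \<phi> \<sigma> = (if 0 = 0 then 0 else coboundary (0 - 1) \<eta> \<sigma>)"
    from this[OF assms(2)] show ?thesis by simp
  qed
qed

lemma cohomology_pullback_one:
  assumes "continuous_map X Y f"
  shows "cohomology_pullback 0 X f (cohomology_one Y) = cohomology_one X"
proof -
  have "(\<lambda>_. 1) \<in> cohomology_one Y"
    unfolding cohomology_one_def by (rule cohomology_class_self[OF one_cocycle])
  from cohomology_pullback_class(2)[OF cohomology_one_in_cohomology this assms]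
  show ?thesis by (simp add: cohomology_one_def)
qed

lemma singular_0_simplex_at_point:
  assumes "singular_simplex p X \<sigma>" "g ` standard_simplex 0 \<subseteq> standard_simplex p"
  shows "singular_simplex 0 X (restrict (\<lambda>x. \<sigma> (g x)) (standard_simplex 0))"
proof -
  let ?e = "\<lambda>j::nat. if j = 0 then 1 else 0 :: real"
  have "\<sigma> (g ?e) \<in> topspace X"
    using assms unfolding singular_simplex_def continuous_map_def
    by (auto simp: standard_simplex_0 Pi_iff)
  then have "continuous_map (subtopology (powertop_real UNIV) (standard_simplex 0)) X (\<lambda>_. \<sigma> (g ?e))"
    by simp
  then have "continuous_map (subtopology (powertop_real UNIV) (standard_simplex 0)) X
      (restrict (\<lambda>x. \<sigma> (g x)) (standard_simplex 0))"
    by (rule continuous_map_eq) (simp add: standard_simplex_0)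
  then show ?thesis by (simp add: singular_simplex_def)
qed

text \<open>
  A representative of the unit takes the value 1 on every singular 0-simplex, so multiplying with
  it does not change the values of a cochain on simplices.
\<close>

lemma cup_product_one_right:
  assumes "a \<in> cohomology p X"
  shows "cup_product p 0 X a (cohomology_one X) = a"
  unfolding cup_product_def
proof (intro cohomology_UN_const[OF assms] cohomology_UN_const[OF cohomology_one_in_cohomology])
  fix \<phi> \<psi> assume \<phi>: "\<phi> \<in> a" and \<psi>: "\<psi> \<in> cohomology_one X"
  have "(\<phi>, cup_cochain p 0 \<phi> \<psi>) \<in> cohomologous p X"
  proof (rule cohomologous_if_equal_on_simplices[OF cohomology_class(2)[OF assms \<phi>]])
    fix \<sigma> assume \<sigma>: "singular_simplex p X \<sigma>"
    have "front_face p \<sigma> = \<sigma>"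
      using \<sigma> by (simp add: front_face_def singular_simplex_def extensional_restrict)
    moreover have "{..p} \<inter> - {i. i < p} = {p}" by auto
    then have "singular_simplex 0 X (back_face p 0 \<sigma>)"
      unfolding back_face_def
      by (intro singular_0_simplex_at_point[OF \<sigma>])
         (auto simp: standard_simplex_0 standard_simplex_def sum.If_cases if_distrib cong: if_cong)
    ultimately show "\<phi> \<sigma> = cup_cochain p 0 \<phi> \<psi> \<sigma>"
      using cohomology_one_value[OF \<psi>] by (simp add: cup_cochain_def)
  qed
  from equiv_class_eq[OF equiv_cohomologous this]
  show "cohomologous (p + 0) X `` {cup_cochain p 0 \<phi> \<psi>} = a"
    using cohomology_class(1)[OF assms \<phi>] by simp
qed

lemma cup_product_one_left:
  assumes "a \<in> cohomology p X"
  shows "cup_product 0 p X (cohomology_one X) a = a"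
  unfolding cup_product_def
proof (intro cohomology_UN_const[OF assms] cohomology_UN_const[OF cohomology_one_in_cohomology])
  fix \<phi> \<psi> assume \<phi>: "\<phi> \<in> a" and \<psi>: "\<psi> \<in> cohomology_one X"
  have "(\<phi>, cup_cochain 0 p \<psi> \<phi>) \<in> cohomologous p X"
  proof (rule cohomologous_if_equal_on_simplices[OF cohomology_class(2)[OF assms \<phi>]])
    fix \<sigma> assume \<sigma>: "singular_simplex p X \<sigma>"
    have "back_face 0 p \<sigma> = \<sigma>"
      using \<sigma> by (simp add: back_face_def singular_simplex_def extensional_restrict)
    moreover have "singular_simplex 0 X (front_face 0 \<sigma>)"
      unfolding front_face_def
      using singular_0_simplex_at_point[OF \<sigma>, of "\<lambda>x. x"] standard_simplex_mono[of 0 p] by simp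
    ultimately show "\<phi> \<sigma> = cup_cochain 0 p \<psi> \<phi> \<sigma>"
      using cohomology_one_value[OF \<psi>] by (simp add: cup_cochain_def)
  qed
  from equiv_class_eq[OF equiv_cohomologous this]
  show "cohomologous (0 + p) X `` {cup_cochain 0 p \<psi> \<phi>} = a"
    using cohomology_class(1)[OF assms \<phi>] by simp
qed

lemma cohomology_add_class:
  assumes a: "a \<in> cohomology p X" "\<phi> \<in> a" and b: "b \<in> cohomology p X" "\<psi> \<in> b"
  shows "(\<lambda>\<sigma>. \<phi> \<sigma> + \<psi> \<sigma>) \<in> cocycles p X"
    and "cohomology_add p X a b = cohomologous p X `` {\<lambda>\<sigma>. \<phi> \<sigma> + \<psi> \<sigma>}"
proof -
  have cocycle: "(\<lambda>\<sigma>. \<phi> \<sigma> + \<psi> \<sigma>) \<in> cocycles p X" if "\<phi> \<in> a" "\<psi> \<in> b" for \<phi> \<psi>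
    using cohomology_class(2)[OF a(1) that(1)] cohomology_class(2)[OF b(1) that(2)]
    unfolding cocycles_def by (simp add: coboundary_add)
  show 1: "(\<lambda>\<sigma>. \<phi> \<sigma> + \<psi> \<sigma>) \<in> cocycles p X" using cocycle a(2) b(2) by blast
  show "cohomology_add p X a b = cohomologous p X `` {\<lambda>\<sigma>. \<phi> \<sigma> + \<psi> \<sigma>}"
    unfolding cohomology_add_def
  proof (intro cohomology_UN_const[OF a(1)] cohomology_UN_const[OF b(1)])
    fix \<phi>' \<psi>' assume mem: "\<phi>' \<in> a" "\<psi>' \<in> b"
    have "(\<phi>, \<phi>') \<in> cohomologous p X" "(\<psi>, \<psi>') \<in> cohomologous p X"
      using cohomology_class(1)[OF a] cohomology_class(1)[OF b] mem by blast+
    then obtain \<eta> \<theta> where \<eta>: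
      "\<And>\<sigma>. singular_simplex p X \<sigma> \<Longrightarrow> \<phi> \<sigma> - \<phi>' \<sigma> = (if p = 0 then 0 else coboundary (p - 1) \<eta> \<sigma>)"
      and \<theta>: "\<And>\<sigma>. singular_simplex p X \<sigma> \<Longrightarrow> \<psi> \<sigma> - \<psi>' \<sigma> = (if p = 0 then 0 else coboundary (p - 1) \<theta> \<sigma>)"
      by (elim cohomologousE) blast
    have "\<phi> \<sigma> + \<psi> \<sigma> - (\<phi>' \<sigma> + \<psi>' \<sigma>) = (if p = 0 then 0 else coboundary (p - 1) (\<lambda>\<sigma>. \<eta> \<sigma> + \<theta> \<sigma>) \<sigma>)"
      if "singular_simplex p X \<sigma>" for \<sigma>
      using \<eta>[OF that] \<theta>[OF that] by (simp add: coboundary_add split: if_splits)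
    then have "((\<lambda>\<sigma>. \<phi> \<sigma> + \<psi> \<sigma>), (\<lambda>\<sigma>. \<phi>' \<sigma> + \<psi>' \<sigma>)) \<in> cohomologous p X"
      by (rule cohomologousI[OF 1 cocycle[OF mem]])
    from equiv_class_eq[OF equiv_cohomologous this]
    show "cohomologous p X `` {\<lambda>\<sigma>. \<phi>' \<sigma> + \<psi>' \<sigma>} = cohomologous p X `` {\<lambda>\<sigma>. \<phi> \<sigma> + \<psi> \<sigma>}" by simp
  qed
qed

lemma singular_simplex_path_simplex:
  assumes "pathin X \<gamma>"
  shows "singular_simplex 1 X (path_simplex \<gamma>)"
proof -
  let ?S = "subtopology (powertop_real UNIV) (standard_simplex 1)"
  have "continuous_map ?S euclideanreal (\<lambda>x. x 1)"
    using continuous_map_product_coordinates[of "Suc 0" UNIV "\<lambda>_. euclideanreal"]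
    by (intro continuous_map_from_subtopology) simp
  then have "continuous_map ?S (top_of_set {0..1}) (\<lambda>x. x 1)"
    by (auto simp: continuous_map_in_subtopology standard_simplex_def)
  from continuous_map_compose[OF this assms[unfolded pathin_def]]
  have "continuous_map ?S X (\<lambda>x. \<gamma> (x 1))" by (simp add: o_def)
  then have "continuous_map ?S X (path_simplex \<gamma>)"
    unfolding path_simplex_def by (rule continuous_map_eq) simp
  then show ?thesis by (simp add: singular_simplex_def path_simplex_def)
qed

text \<open>
  The two faces of the 1-simplex of a loop coincide, so coboundaries vanish on it.
\<close>

lemma cohomologous_equal_on_loops:
  assumes "(\<phi>, \<psi>) \<in> cohomologous 1 X" "pathin X \<gamma>" "\<gamma> 0 = \<gamma> 1"
  shows "\<phi> (path_simplex \<gamma>) = \<psi> (path_simplex \<gamma>)"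
proof -
  obtain \<eta> where \<eta>: "\<And>\<sigma>. singular_simplex 1 X \<sigma> \<Longrightarrow> \<phi> \<sigma> - \<psi> \<sigma> = coboundary 0 \<eta> \<sigma>"
    using cohomologousE[OF assms(1)] by (metis diff_self_eq_0 zero_neq_one)
  have mem: "simplical_face k x \<in> standard_simplex 1" if "x \<in> standard_simplex 0" "k \<le> 1" for k and x :: "nat \<Rightarrow> real"
    using simplical_face_in_standard_simplex[of 1 k x] that by simp
  have "singular_face 1 0 (path_simplex \<gamma>) = restrict (\<lambda>_. \<gamma> 1) (standard_simplex 0)"
    unfolding singular_face_def path_simplex_def using mem[of _ 0]
    by (auto simp: restrict_def fun_eq_iff simplical_face_def standard_simplex_0)
  moreover have "singular_face 1 1 (path_simplex \<gamma>) = restrict (\<lambda>_. \<gamma> 0) (standard_simplex 0)"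
    unfolding singular_face_def path_simplex_def using mem[of _ 1]
    by (auto simp: restrict_def fun_eq_iff simplical_face_def standard_simplex_0)
  ultimately have "coboundary 0 \<eta> (path_simplex \<gamma>) = 0"
    using assms(3) by (simp add: coboundary_def)
  then show ?thesis using \<eta>[OF singular_simplex_path_simplex[OF assms(2)]] by simp
qed

text \<open>
  With the unit classes removed, the class on the product is the sum of the pullbacks under the
  two projections; on a loop it is the sum of the periods of the two coordinate loops.
\<close>

lemma represents_cross_sum:
  assumes X: "represents X \<omega>\<^sub>X \<xi>\<^sub>X" and Y: "represents Y \<omega>\<^sub>Y \<xi>\<^sub>Y"
    and \<omega>: "\<omega> \<in> closed_1_forms (prod_topology X Y)"
    and int: "\<And>\<gamma>. pathin (prod_topology X Y) \<gamma> \<Longrightarrow> form_integral \<omega> \<gamma> =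
           form_integral \<omega>\<^sub>X (\<lambda>t. fst (\<gamma> t)) + form_integral \<omega>\<^sub>Y (\<lambda>t. snd (\<gamma> t))"
  shows "represents (prod_topology X Y) \<omega>
     (cohomology_add 1 (prod_topology X Y)
               (cross_product 1 0 X Y \<xi>\<^sub>X (cohomology_one Y))
               (cross_product 0 1 X Y (cohomology_one X) \<xi>\<^sub>Y))"
proof -
  let ?P = "prod_topology X Y"
  have \<xi>: "\<xi>\<^sub>X \<in> cohomology 1 X" "\<xi>\<^sub>Y \<in> cohomology 1 Y"
    using X Y by (simp_all add: represents_def)
  obtain \<phi> where \<phi>: "\<phi> \<in> \<xi>\<^sub>X" by (rule cohomology_representative[OF \<xi>(1)])
  obtain \<psi> where \<psi>: "\<psi> \<in> \<xi>\<^sub>Y" by (rule cohomology_representative[OF \<xi>(2)])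
  define \<alpha> where "\<alpha> = (\<lambda>\<sigma> :: (nat \<Rightarrow> real) \<Rightarrow> 'a \<times> 'b. \<phi> (simplex_map 1 fst \<sigma>))"
  define \<beta> where "\<beta> = (\<lambda>\<sigma> :: (nat \<Rightarrow> real) \<Rightarrow> 'a \<times> 'b. \<psi> (simplex_map 1 snd \<sigma>))"
  have \<alpha>: "\<alpha> \<in> cocycles 1 ?P" "cohomology_pullback 1 ?P fst \<xi>\<^sub>X = cohomologous 1 ?P `` {\<alpha>}"
    unfolding \<alpha>_def by (rule cohomology_pullback_class[OF \<xi>(1) \<phi> continuous_map_fst])+
  have \<beta>: "\<beta> \<in> cocycles 1 ?P" "cohomology_pullback 1 ?P snd \<xi>\<^sub>Y = cohomologous 1 ?P `` {\<beta>}"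
    unfolding \<beta>_def by (rule cohomology_pullback_class[OF \<xi>(2) \<psi> continuous_map_snd])+
  have "cross_product 1 0 X Y \<xi>\<^sub>X (cohomology_one Y) = cohomologous 1 ?P `` {\<alpha>}"
    unfolding cross_product_def \<alpha>(2) cohomology_pullback_one[OF continuous_map_snd]
    by (rule cup_product_one_right[OF cohomology_classI[OF \<alpha>(1)]])
  moreover have "cross_product 0 1 X Y (cohomology_one X) \<xi>\<^sub>Y = cohomologous 1 ?P `` {\<beta>}"
    unfolding cross_product_def \<beta>(2) cohomology_pullback_one[OF continuous_map_fst]
    by (rule cup_product_one_left[OF cohomology_classI[OF \<beta>(1)]])
  ultimately have sum: "cohomology_add 1 ?P (cross_product 1 0 X Y \<xi>\<^sub>X (cohomology_one Y))
      (cross_product 0 1 X Y (cohomology_one X) \<xi>\<^sub>Y) = cohomologous 1 ?P `` {\<lambda>\<sigma>. \<alpha> \<sigma> + \<beta> \<sigma>}"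
    and cocycle: "(\<lambda>\<sigma>. \<alpha> \<sigma> + \<beta> \<sigma>) \<in> cocycles 1 ?P"
    using cohomology_add_class[OF cohomology_classI[OF \<alpha>(1)] cohomology_class_self[OF \<alpha>(1)]
        cohomology_classI[OF \<beta>(1)] cohomology_class_self[OF \<beta>(1)]] by simp_all
  have "\<kappa> (path_simplex \<gamma>) = form_integral \<omega> \<gamma>"
    if \<kappa>: "\<kappa> \<in> cohomologous 1 ?P `` {\<lambda>\<sigma>. \<alpha> \<sigma> + \<beta> \<sigma>}" and \<gamma>: "pathin ?P \<gamma>" "\<gamma> 0 = \<gamma> 1" for \<kappa> \<gamma>
  proof -
    have "((\<lambda>\<sigma>. \<alpha> \<sigma> + \<beta> \<sigma>), \<kappa>) \<in> cohomologous 1 ?P" using \<kappa> by simp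
    from cohomologous_equal_on_loops[OF this \<gamma>]
    have "\<kappa> (path_simplex \<gamma>) = \<alpha> (path_simplex \<gamma>) + \<beta> (path_simplex \<gamma>)" by simp
    also have "\<alpha> (path_simplex \<gamma>) = \<phi> (path_simplex (\<lambda>t. fst (\<gamma> t)))"
      unfolding \<alpha>_def simplex_map_def path_simplex_def by (rule arg_cong[of _ _ \<phi>]) (auto simp: restrict_def)
    also have "\<dots> = form_integral \<omega>\<^sub>X (\<lambda>t. fst (\<gamma> t))"
      using X \<phi> \<gamma>(2) pathin_compose[OF \<gamma>(1) continuous_map_fst] unfolding represents_def by (simp add: o_def)
    also have "\<beta> (path_simplex \<gamma>) = \<psi> (path_simplex (\<lambda>t. snd (\<gamma> t)))"
      unfolding \<beta>_def simplex_map_def path_simplex_def by (rule arg_cong[of _ _ \<psi>]) (auto simp: restrict_def)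
    also have "\<dots> = form_integral \<omega>\<^sub>Y (\<lambda>t. snd (\<gamma> t))"
      using Y \<psi> \<gamma>(2) pathin_compose[OF \<gamma>(1) continuous_map_snd] unfolding represents_def by (simp add: o_def)
    finally show ?thesis using int[OF \<gamma>(1)] by simp
  qed
  then show ?thesis
    unfolding represents_def sum using \<omega> cohomology_classI[OF cocycle] by blast
qed

section \<open>Null-homotopic and movable open sets\<close>

lemma openin_less:
  fixes f g :: "'a \<Rightarrow> real"
  assumes "continuous_map X euclideanreal f" "continuous_map X euclideanreal g"
  shows "openin X {x \<in> topspace X. f x < g x}"
proof -
  have "openin X {x \<in> topspace X. g x - f x \<in> {0<..}}"
    by (rule openin_continuous_map_preimage[OF continuous_map_diff[OF assms(2,1)]]) simp
  then show ?thesis by simp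
qed

text \<open>
  An unnormalised partition of unity on a closed set, subordinate to a finite open cover. In the
  inductive step, Urysohn's lemma gives a function for the new member that is 1 on the part that
  the other members miss.
\<close>

lemma shrinking_functions:
  assumes "normal_space X" and "finite I" and "\<And>i. i \<in> I \<Longrightarrow> openin X (U i)"
    and "closedin X K" and "K \<subseteq> (\<Union>i\<in>I. U i)"
  shows "\<exists>a :: 'i \<Rightarrow> 'a \<Rightarrow> real. (\<forall>i\<in>I. continuous_map X euclideanreal (a i) \<and>
             (\<forall>x\<in>topspace X. 0 \<le> a i x \<and> (0 < a i x \<longrightarrow> x \<in> U i))) \<and>
           (\<forall>x\<in>K. \<exists>i\<in>I. 0 < a i x)"
  using assms(2-)
proof (induction arbitrary: K)
  case empty
  then show ?case by simp
next
  case (insert j I)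
  let ?S = "topspace X - U j" and ?T = "K - (\<Union>i\<in>I. U i)"
  have "closedin X ?S" using insert.prems(1) by (intro closedin_diff) auto
  moreover have "openin X (\<Union>i\<in>I. U i)" using insert.prems(1) by (intro openin_Union) auto
  then have "closedin X ?T" using insert.prems(2) by (intro closedin_diff)
  moreover have "disjnt ?S ?T" using insert.prems(3) unfolding disjnt_def by blast
  ultimately obtain g :: "'a \<Rightarrow> real" where g: "continuous_map X (top_of_set {0..1}) g"
      and g0: "g ` ?S \<subseteq> {0}" and g1: "g ` ?T \<subseteq> {1}"
    using Urysohn_lemma[OF assms(1), of ?S ?T 0 1] by auto
  have gc: "continuous_map X euclideanreal g" using g by (simp add: continuous_map_in_subtopology)
  have gr: "0 \<le> g x" if "x \<in> topspace X" for x
    using g that by (auto simp: continuous_map_in_subtopology)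
  let ?K' = "K - {x \<in> topspace X. 0 < g x}"
  have "openin X {x \<in> topspace X. 0 < g x}"
    using openin_less[OF _ gc, of "\<lambda>_. 0"] by simp
  then have "closedin X ?K'" using insert.prems(2) by (intro closedin_diff)
  moreover have "?K' \<subseteq> (\<Union>i\<in>I. U i)"
  proof
    fix x assume x: "x \<in> ?K'"
    show "x \<in> (\<Union>i\<in>I. U i)"
    proof (rule ccontr)
      assume "x \<notin> (\<Union>i\<in>I. U i)"
      then have "g x = 1" using x g1 by blast
      moreover have "x \<in> topspace X" using x closedin_subset[OF insert.prems(2)] by blast
      ultimately show False using x by simp
    qed
  qed
  ultimately obtain a :: "'i \<Rightarrow> 'a \<Rightarrow> real" where
    a: "\<forall>i\<in>I. continuous_map X euclideanreal (a i) \<and>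
             (\<forall>x\<in>topspace X. 0 \<le> a i x \<and> (0 < a i x \<longrightarrow> x \<in> U i))"
    and cov: "\<forall>x\<in>?K'. \<exists>i\<in>I. 0 < a i x"
    using insert.IH[of ?K'] insert.prems(1) by blast
  have g_supp: "x \<in> U j" if "x \<in> topspace X" "0 < g x" for x
  proof (rule ccontr)
    assume "x \<notin> U j"
    then have "g x = 0" using g0 that(1) by blast
    then show False using that(2) by simp
  qed
  show ?case
  proof (intro exI conjI ballI)
    fix i assume i: "i \<in> insert j I"
    show "continuous_map X euclideanreal ((a(j := g)) i)"
      using a i gc by auto
    fix x assume x: "x \<in> topspace X"
    show "0 \<le> (a(j := g)) i x" using a i gr x by auto
    show "0 < (a(j := g)) i x \<longrightarrow> x \<in> U i" using a i g_supp x by auto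
  next
    fix x assume x: "x \<in> K"
    then have xt: "x \<in> topspace X" using closedin_subset[OF insert.prems(2)] by blast
    show "\<exists>i\<in>insert j I. 0 < (a(j := g)) i x"
    proof (cases "0 < g x")
      case False
      then obtain i where "i \<in> I" "0 < a i x" using cov x xt by blast
      moreover have "i \<noteq> j" using \<open>i \<in> I\<close> insert.hyps by blast
      ultimately show ?thesis by auto
    qed auto
  qed
qed

lemma null_homotopic_in_mono:
  assumes "null_homotopic_in X A" "B \<subseteq> A"
  shows "null_homotopic_in X B"
proof -
  obtain c where c: "homotopic_with (\<lambda>_. True) (subtopology X A) X (\<lambda>x. x) (\<lambda>_. c)"
    using assms(1) unfolding null_homotopic_in_def by blast
  have "continuous_map (subtopology X B) (subtopology X A) (\<lambda>x. x)"
    using assms(2) by (auto simp: continuous_map_in_subtopology continuous_map_from_subtopology)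
  from homotopic_with_compose_continuous_map_right[OF c this, of "\<lambda>_. True"]
  show ?thesis unfolding null_homotopic_in_def by (auto simp: o_def)
qed

lemma null_homotopic_in_Times:
  assumes "null_homotopic_in X A" "null_homotopic_in Y B"
  shows "null_homotopic_in (prod_topology X Y) (A \<times> B)"
proof -
  obtain c where c: "homotopic_with (\<lambda>_. True) (subtopology X A) X (\<lambda>x. x) (\<lambda>_. c)"
    using assms(1) unfolding null_homotopic_in_def by blast
  obtain d where d: "homotopic_with (\<lambda>_. True) (subtopology Y B) Y (\<lambda>x. x) (\<lambda>_. d)"
    using assms(2) unfolding null_homotopic_in_def by blast
  from homotopic_with_prod_topology[OF c d, of "\<lambda>_. True"]
  show ?thesis unfolding null_homotopic_in_def by (auto simp: subtopology_Times)
qed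

lemma null_homotopic_in_path_connected_target:
  assumes "path_connected_space X" "c \<in> topspace X" and A: "null_homotopic_in X A"
  shows "homotopic_with (\<lambda>_. True) (subtopology X A) X (\<lambda>x. x) (\<lambda>_. c)"
proof -
  obtain d where d: "homotopic_with (\<lambda>_. True) (subtopology X A) X (\<lambda>x. x) (\<lambda>_. d)"
    using A unfolding null_homotopic_in_def by blast
  have "homotopic_with (\<lambda>_. True) (subtopology X A) X (\<lambda>_. d) (\<lambda>_. c)"
  proof (cases "subtopology X A = trivial_topology")
    case False
    then have "topspace (subtopology X A) \<noteq> {}" by (simp only: null_topspace_iff_trivial not_False_eq_True)
    then obtain x where "x \<in> topspace (subtopology X A)" by blast
    then have "d \<in> topspace X"
      using homotopic_with_imp_continuous_maps[OF d] by (auto simp: continuous_map_def)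
    then have "path_component_of X d c"
      using assms(1,2) unfolding path_connected_space_iff_path_component by blast
    then show ?thesis by (simp add: homotopic_constant_maps)
  qed (simp add: homotopic_constant_maps)
  with d show ?thesis by (rule homotopic_with_trans)
qed

text \<open>
  All pieces are contracted to the same point, using path-connectedness; as they are open and
  disjoint, the contractions paste together.
\<close>

lemma null_homotopic_in_disjoint_Union:
  assumes pc: "path_connected_space X" and op: "\<And>i. i \<in> I \<Longrightarrow> openin X (W i)"
    and disj: "\<And>i j. i \<in> I \<Longrightarrow> j \<in> I \<Longrightarrow> i \<noteq> j \<Longrightarrow> W i \<inter> W j = {}"
    and null: "\<And>i. i \<in> I \<Longrightarrow> null_homotopic_in X (W i)"
  shows "null_homotopic_in X (\<Union>i\<in>I. W i)"
proof (cases "topspace X = {}")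
  case True
  then have "subtopology X (\<Union>i\<in>I. W i) = trivial_topology" by (simp add: null_topspace_iff_trivial)
  then show ?thesis
    unfolding null_homotopic_in_def
    by (intro exI[of _ undefined] homotopic_with_equal) auto
next
  case False
  then obtain c where c: "c \<in> topspace X" by blast
  let ?I = "top_of_set {0..1::real}"
  have "\<exists>h. continuous_map (prod_topology ?I (subtopology X (W i))) X h \<and>
      (\<forall>x. h (0, x) = x) \<and> (\<forall>x. h (1, x) = c)" if "i \<in> I" for i
    using null_homotopic_in_path_connected_target[OF pc c null[OF that]]
    unfolding homotopic_with_def by blast
  then obtain h where h: "\<And>i. i \<in> I \<Longrightarrow> continuous_map (prod_topology ?I (subtopology X (W i))) X (h i)"
    and h0: "\<And>i x. i \<in> I \<Longrightarrow> h i (0, x) = x" and h1: "\<And>i x. i \<in> I \<Longrightarrow> h i (1, x) = c"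
    by metis
  let ?U = "\<Union>i\<in>I. W i"
  let ?D = "prod_topology ?I (subtopology X ?U)"
  let ?T = "\<lambda>i. {0..1::real} \<times> W i"
  obtain g where g: "continuous_map ?D X g"
    and gh: "\<And>z i. i \<in> I \<Longrightarrow> z \<in> topspace ?D \<inter> ?T i \<Longrightarrow> g z = h i z"
  proof (rule pasting_lemma_exists[where X = ?D and I = I and T = ?T and Y = X and f = h])
    show "topspace ?D \<subseteq> (\<Union>i\<in>I. ?T i)" by auto
    show "openin ?D (?T i)" if "i \<in> I" for i
    proof -
      have "openin (subtopology X ?U) (W i)"
        using op[OF that] that by (auto simp: openin_subtopology)
      then show ?thesis by (simp add: openin_prod_Times_iff)
    qed
    show "continuous_map (subtopology ?D (?T i)) X (h i)" if "i \<in> I" for i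
    proof -
      have "subtopology ?D (?T i) = prod_topology ?I (subtopology X (?U \<inter> W i))"
        by (simp add: subtopology_Times subtopology_subtopology)
      moreover have "?U \<inter> W i = W i" using that by blast
      ultimately show ?thesis using h[OF that] by simp
    qed
    show "h i z = h j z" if "i \<in> I" "j \<in> I" "z \<in> topspace ?D \<inter> ?T i \<inter> ?T j" for i j z
      using disj[OF that(1,2)] that(3) by (cases "i = j") auto
  qed blast
  have "homotopic_with (\<lambda>_. True) (subtopology X ?U) X (\<lambda>x. x) (\<lambda>_. c)"
  proof (subst homotopic_with)
    have "g (0, x) = x \<and> g (1, x) = c" if "x \<in> topspace (subtopology X ?U)" for x
    proof -
      have "x \<in> (\<Union>i\<in>I. W i)" "x \<in> topspace X"
        using that unfolding topspace_subtopology by (rule IntD2, rule IntD1)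
      then obtain i where i: "i \<in> I" "x \<in> W i" by blast
      have "(0, x) \<in> topspace ?D \<inter> ?T i" "(1, x) \<in> topspace ?D \<inter> ?T i"
        using i \<open>x \<in> topspace X\<close> by auto
      then have "g (0, x) = h i (0, x)" "g (1, x) = h i (1, x)"
        using gh[OF i(1)] by blast+
      then show ?thesis using h0[OF i(1), of x] h1[OF i(1), of x] by simp
    qed
    with g show "\<exists>h. continuous_map ?D X h \<and> (\<forall>x\<in>topspace (subtopology X ?U). h (0, x) = x) \<and>
        (\<forall>x\<in>topspace (subtopology X ?U). h (1, x) = c) \<and> (\<forall>t\<in>{0..1}. True)" by blast
  qed simp
  then show ?thesis unfolding null_homotopic_in_def by blast
qed

text \<open>
  The homotopy on the movable set is slowed down by a cut-off function that is 1 on a smaller open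
  set and vanishes near the boundary, so that it extends by the identity. Slowing down replaces the
  path of a point by an initial segment of it; hence the control on all initial segments, and not
  only on the whole path, is what bounds the integrals of the extended homotopy.
\<close>

lemma movable_extend:
  assumes X: "normal_space X" and \<omega>: "\<omega> \<in> closed_1_forms X" and mov: "movable X \<omega> N C F"
    and F: "openin X F" and S: "closedin X S" "S \<subseteq> F" and "C \<ge> 0"
  obtains H F' where "continuous_map (prod_topology (top_of_set {0..1::real}) X) X H"
    and "\<And>x. x \<in> topspace X \<Longrightarrow> H (0, x) = x"
    and "\<And>x t. x \<in> topspace X \<Longrightarrow> t \<in> {0..1} \<Longrightarrow> form_integral \<omega> (\<lambda>\<tau>. H (\<tau> * t, x)) \<le> C"
    and "openin X F'" "S \<subseteq> F'"
    and "\<And>x. x \<in> F' \<Longrightarrow> form_integral \<omega> (\<lambda>\<tau>. H (\<tau>, x)) < - N"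
proof -
  let ?I = "top_of_set {0..1::real}"
  obtain h where h: "continuous_map (prod_topology ?I (subtopology X F)) X h"
    and h0: "\<And>x. x \<in> F \<Longrightarrow> h (0, x) = x"
    and hN: "\<And>x. x \<in> F \<Longrightarrow> form_integral \<omega> (\<lambda>\<tau>. h (\<tau>, x)) < - N"
    and hC: "\<And>x t. x \<in> F \<Longrightarrow> t \<in> {0..1} \<Longrightarrow> form_integral \<omega> (\<lambda>\<tau>. h (\<tau> * t, x)) \<le> C"
    using mov unfolding movable_def by blast
  have "closedin X (topspace X - F)" using F by blast
  moreover have "disjnt (topspace X - F) S" using S(2) unfolding disjnt_def by blast
  ultimately obtain g :: "'a \<Rightarrow> real" where g: "continuous_map X (top_of_set {0..1}) g"
      and g0: "g ` (topspace X - F) \<subseteq> {0}" and g1: "g ` S \<subseteq> {1}"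
    using Urysohn_lemma[OF X, of "topspace X - F" S 0 1] S(1) by auto
  have gc: "continuous_map X euclideanreal g" using g by (simp add: continuous_map_in_subtopology)
  have g_pos: "x \<in> F" if "x \<in> topspace X" "0 < g x" for x
  proof (rule ccontr)
    assume "x \<notin> F"
    then have "g x = 0" using g0 that(1) by blast
    then show False using that(2) by simp
  qed
  \<comment> \<open>Equal to 1 where \<open>g \<ge> 2/3\<close> and to 0 where \<open>g \<le> 1/3\<close>; the latter contains an open neighbourhood
    of the complement of \<open>F\<close>, on which the extension is the identity.\<close>
  define \<phi> where "\<phi> x = max 0 (min 1 (3 * g x - 1))" for x
  have \<phi>c: "continuous_map X ?I \<phi>"
    unfolding continuous_map_in_subtopology \<phi>_def
    by (auto intro!: continuous_intros gc)
  have \<phi>r: "0 \<le> \<phi> x \<and> \<phi> x \<le> 1" for x unfolding \<phi>_def by auto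
  define H where "H z = (if snd z \<in> F then h (\<phi> (snd z) * fst z, snd z) else snd z)" for z
  let ?D = "prod_topology ?I X"
  let ?Z = "{x \<in> topspace X. g x < 1/3}"
  have Hc: "continuous_map ?D X H"
  proof (rule pasting_lemma[where I = "{True, False}" and T = "\<lambda>b. {0..1} \<times> (if b then F else ?Z)"
        and f = "\<lambda>b z. if b then h (\<phi> (snd z) * fst z, snd z) else snd z"])
    show "openin ?D ({0..1} \<times> (if b then F else ?Z))" for b
      using F openin_less[OF gc, of "\<lambda>_. 1/3"] by (simp add: openin_prod_Times_iff)
    show "continuous_map (subtopology ?D ({0..1} \<times> (if b then F else ?Z))) X
        (\<lambda>z. if b then h (\<phi> (snd z) * fst z, snd z) else snd z)" for b
    proof (cases b)
      case True
      let ?P = "prod_topology ?I (subtopology X F)"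
      have 1: "continuous_map ?P ?I (\<lambda>z. \<phi> (snd z))"
        using continuous_map_compose[OF continuous_map_snd continuous_map_from_subtopology[OF \<phi>c]]
        by (simp add: o_def)
      have "continuous_map ?P euclideanreal (\<lambda>z. \<phi> (snd z))"
        using continuous_map_into_fulltopology[OF 1] .
      moreover have "continuous_map ?P euclideanreal fst"
        by (rule continuous_map_into_fulltopology[OF continuous_map_fst])
      ultimately have "continuous_map ?P euclideanreal (\<lambda>z. \<phi> (snd z) * fst z)"
        by (rule continuous_map_real_mult)
      moreover have "(\<lambda>z. \<phi> (snd z) * fst z) \<in> topspace ?P \<rightarrow> {0..1}"
        using \<phi>r by (auto intro!: mult_nonneg_nonneg mult_le_one simp del: mult_le_cancel_left1 mult_le_cancel_right1)
      ultimately have "continuous_map ?P ?I (\<lambda>z. \<phi> (snd z) * fst z)"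
        by (simp add: continuous_map_in_subtopology image_subset_iff_funcset)
      then have "continuous_map ?P ?P (\<lambda>z. (\<phi> (snd z) * fst z, snd z))"
        by (intro continuous_map_pairedI continuous_map_snd)
      from continuous_map_compose[OF this h] show ?thesis
        using True by (simp add: o_def subtopology_Times subtopology_subtopology)
    next
      case False
      then show ?thesis
        by (simp add: continuous_map_from_subtopology continuous_map_snd)
    qed
    show "(if b then h (\<phi> (snd z) * fst z, snd z) else snd z) = (if b' then h (\<phi> (snd z) * fst z, snd z) else snd z)"
      if "b \<in> {True, False}" "b' \<in> {True, False}"
        "z \<in> topspace ?D \<inter> ({0..1} \<times> (if b then F else ?Z)) \<inter> ({0..1} \<times> (if b' then F else ?Z))" for b b' z
    proof (cases "b = b'")
      case False
      then have "snd z \<in> F" "g (snd z) < 1/3" using that(3) by (auto split: if_splits)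
      then have "h (\<phi> (snd z) * fst z, snd z) = snd z" using h0 by (simp add: \<phi>_def)
      then show ?thesis by simp
    qed simp
    show "\<exists>b. b \<in> {True, False} \<and> z \<in> {0..1} \<times> (if b then F else ?Z) \<and>
        H z = (if b then h (\<phi> (snd z) * fst z, snd z) else snd z)" if z: "z \<in> topspace ?D" for z
    proof (cases "snd z \<in> F")
      case True
      then show ?thesis using z by (intro exI[of _ True]) (auto simp: H_def)
    next
      case False
      then have "g (snd z) \<le> 0" using g_pos[of "snd z"] z by fastforce
      then show ?thesis using False z by (intro exI[of _ False]) (auto simp: H_def)
    qed
  qed
  let ?F' = "{x \<in> topspace X. 2/3 < g x}"
  show thesis
  proof (rule that[OF Hc])
    show "H (0, x) = x" if "x \<in> topspace X" for x
      using h0 by (simp add: H_def)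
    show "form_integral \<omega> (\<lambda>\<tau>. H (\<tau> * t, x)) \<le> C" if x: "x \<in> topspace X" and t: "t \<in> {0..1}" for x t
    proof (cases "x \<in> F")
      case True
      have "(\<lambda>\<tau>. H (\<tau> * t, x)) = (\<lambda>\<tau>. h (\<tau> * (\<phi> x * t), x))"
        using True by (simp add: H_def fun_eq_iff mult.commute mult.left_commute)
      moreover have "\<phi> x * t \<in> {0..1}" using \<phi>r[of x] t by (simp add: mult_le_one)
      ultimately show ?thesis using hC[OF True, of "\<phi> x * t"] by simp
    next
      case False
      then show ?thesis
        using form_integral_const[OF \<omega> x, of "\<lambda>\<tau>. H (\<tau> * t, x)"] \<open>C \<ge> 0\<close> by (simp add: H_def)
    qed
    show "openin X ?F'" using openin_less[OF _ gc, of "\<lambda>_. 2/3"] by simp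
    show "S \<subseteq> ?F'" using closedin_subset[OF S(1)] g1 by fastforce
    show "form_integral \<omega> (\<lambda>\<tau>. H (\<tau>, x)) < - N" if "x \<in> ?F'" for x
    proof -
      have "x \<in> F" "\<phi> x = 1" using g_pos[of x] that by (auto simp: \<phi>_def)
      then have "(\<lambda>\<tau>. H (\<tau>, x)) = (\<lambda>\<tau>. h (\<tau>, x))" by (simp add: H_def)
      then show ?thesis using hN[OF \<open>x \<in> F\<close>] by simp
    qed
  qed
qed

lemma movable_change_form:
  assumes "movable X \<omega> N C A"
    and B: "\<And>\<gamma>. pathin X \<gamma> \<Longrightarrow> \<bar>form_integral \<omega> \<gamma> - form_integral \<omega>' \<gamma>\<bar> \<le> B"
  shows "movable X \<omega>' (N - B) (C + B) A"
proof -
  let ?I = "top_of_set {0..1::real}"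
  obtain h where h: "continuous_map (prod_topology ?I (subtopology X A)) X h"
    and h0: "\<And>x. x \<in> A \<Longrightarrow> h (0, x) = x"
    and hN: "\<And>x. x \<in> A \<Longrightarrow> form_integral \<omega> (\<lambda>\<tau>. h (\<tau>, x)) < - N"
    and hC: "\<And>x t. x \<in> A \<Longrightarrow> t \<in> {0..1} \<Longrightarrow> form_integral \<omega> (\<lambda>\<tau>. h (\<tau> * t, x)) \<le> C"
    and A: "A \<subseteq> topspace X"
    using assms(1) unfolding movable_def by blast
  have path: "pathin X (\<lambda>\<tau>. h (\<tau>, x))" if "x \<in> A" for x
    using pathin_ray[OF h] that A by auto
  have path': "pathin X (\<lambda>\<tau>. h (\<tau> * t, x))" if "x \<in> A" "t \<in> {0..1}" for x t
    by (rule pathin_reparametrize[OF path[OF that(1)]])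
       (use that(2) in \<open>auto intro!: continuous_intros mult_le_one\<close>)
  show ?thesis
    unfolding movable_def
  proof (intro conjI exI[of _ h] ballI)
    show "form_integral \<omega>' (\<lambda>\<tau>. h (\<tau>, x)) < - (N - B)" if "x \<in> A" for x
      using hN[OF that] B[OF path[OF that]] by linarith
    show "form_integral \<omega>' (\<lambda>\<tau>. h (\<tau> * t, x)) \<le> C + B" if "x \<in> A" "t \<in> {0..1}" for x t
      using hC[OF that] B[OF path'[OF that]] by linarith
  qed (use A h h0 in auto)
qed

section \<open>The product inequality\<close>

text \<open>
  The movable set consists of the points with at least one coordinate in the region where the
  extended homotopy of that factor runs at full speed; the other coordinate costs at most its
  control, which the margins added to the two hypotheses absorb.

  The remaining points are sorted by the least indices \<open>i\<close> and \<open>j\<close> of functions \<open>a i\<close>, \<open>b j\<close> that are positive at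
  their coordinates, and collected by the value of \<open>i + j\<close>, which gives the \<open>k + l - 1\<close> sets. These strata
  need not be open. Let \<open>\<alpha>\<close> and \<open>\<beta>\<close> be the partial sums and \<open>s = i + j - 1\<close>. A point of the stratum
  \<open>(i, j)\<close> has \<open>\<alpha> i > 0 = \<beta> (j - 1)\<close> and \<open>\<alpha> (i - 1) = 0 < \<beta> j\<close>. Keeping only
  \<open>\<alpha> i > \<beta> (s - i)\<close> and \<open>\<alpha> (i - 1) < \<beta> (s - (i - 1))\<close> gives open sets; they are still disjoint for fixed \<open>s\<close>,
  since \<open>\<alpha> i - \<beta> (s - i)\<close> is nondecreasing in \<open>i\<close> and can change from negative to positive only once.
\<close>

lemma product_cover:
  fixes X :: "'a topology" and Y :: "'b topology" and k l :: nat
  assumes X: "normal_space X" "\<omega>\<^sub>X \<in> closed_1_forms X" and Y: "normal_space Y" "\<omega>\<^sub>Y \<in> closed_1_forms Y"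
    and int: "\<And>\<gamma>. pathin (prod_topology X Y) \<gamma> \<Longrightarrow> form_integral \<omega> \<gamma> =
           form_integral \<omega>\<^sub>X (\<lambda>t. fst (\<gamma> t)) + form_integral \<omega>\<^sub>Y (\<lambda>t. snd (\<gamma> t))"
    and C: "C \<ge> 0" "D \<ge> 0"
    and F: "openin X F" "movable X \<omega>\<^sub>X (N + D) C F"
    and A: "\<And>i. i \<in> {1..k} \<Longrightarrow> openin X (A i) \<and> null_homotopic_in X (A i)"
    and covX: "topspace X = F \<union> (\<Union>i\<in>{1..k}. A i)"
    and G: "openin Y G" "movable Y \<omega>\<^sub>Y (N + C) D G"
    and B: "\<And>j. j \<in> {1..l} \<Longrightarrow> openin Y (B j) \<and> null_homotopic_in Y (B j)"
    and covY: "topspace Y = G \<union> (\<Union>j\<in>{1..l}. B j)"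
    and pc: "k > 0 \<Longrightarrow> l > 0 \<Longrightarrow> path_connected_space (prod_topology X Y)"
  shows "\<exists>W Q. openin (prod_topology X Y) W \<and> movable (prod_topology X Y) \<omega> N (C + D) W \<and>
     (\<forall>s\<in>{1..k + l - 1}. openin (prod_topology X Y) (Q s) \<and> null_homotopic_in (prod_topology X Y) (Q s)) \<and>
     topspace (prod_topology X Y) = W \<union> (\<Union>s\<in>{1..k + l - 1}. Q s)"
proof -
  let ?P = "prod_topology X Y" and ?I = "top_of_set {0..1::real}"
  have "openin X (\<Union>i\<in>{1..k}. A i)" using A by (intro openin_Union) auto
  then have "closedin X (topspace X - (\<Union>i\<in>{1..k}. A i))" by blast
  moreover have "topspace X - (\<Union>i\<in>{1..k}. A i) \<subseteq> F" using covX by blast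
  ultimately obtain H F' where H: "continuous_map (prod_topology ?I X) X H"
    and H0: "\<And>x. x \<in> topspace X \<Longrightarrow> H (0, x) = x"
    and HC: "\<And>x t. x \<in> topspace X \<Longrightarrow> t \<in> {0..1} \<Longrightarrow> form_integral \<omega>\<^sub>X (\<lambda>\<tau>. H (\<tau> * t, x)) \<le> C"
    and F': "openin X F'" "topspace X - (\<Union>i\<in>{1..k}. A i) \<subseteq> F'"
    and HN: "\<And>x. x \<in> F' \<Longrightarrow> form_integral \<omega>\<^sub>X (\<lambda>\<tau>. H (\<tau>, x)) < - (N + D)"
    using movable_extend[OF X F(2,1) _ _ C(1)] by blast
  have "openin Y (\<Union>j\<in>{1..l}. B j)" using B by (intro openin_Union) auto
  then have "closedin Y (topspace Y - (\<Union>j\<in>{1..l}. B j))" by blast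
  moreover have "topspace Y - (\<Union>j\<in>{1..l}. B j) \<subseteq> G" using covY by blast
  ultimately obtain K G' where K: "continuous_map (prod_topology ?I Y) Y K"
    and K0: "\<And>y. y \<in> topspace Y \<Longrightarrow> K (0, y) = y"
    and KC: "\<And>y t. y \<in> topspace Y \<Longrightarrow> t \<in> {0..1} \<Longrightarrow> form_integral \<omega>\<^sub>Y (\<lambda>\<tau>. K (\<tau> * t, y)) \<le> D"
    and G': "openin Y G'" "topspace Y - (\<Union>j\<in>{1..l}. B j) \<subseteq> G'"
    and KN: "\<And>y. y \<in> G' \<Longrightarrow> form_integral \<omega>\<^sub>Y (\<lambda>\<tau>. K (\<tau>, y)) < - (N + C)"
    using movable_extend[OF Y G(2,1) _ _ C(2)] by blast
  have sub: "F' \<subseteq> topspace X" "G' \<subseteq> topspace Y"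
    using openin_subset[OF F'(1)] openin_subset[OF G'(1)] .
  \<comment> \<open>At least one of the two coordinates moves at full speed.\<close>
  define W where "W = F' \<times> topspace Y \<union> topspace X \<times> G'"
  have W: "openin ?P W"
    unfolding W_def using F'(1) G'(1) by (intro openin_Un) (simp_all add: openin_prod_Times_iff)
  have mov: "movable ?P \<omega> N (C + D) W"
    unfolding movable_def
  proof (intro conjI exI[of _ "\<lambda>z. (H (fst z, fst (snd z)), K (fst z, snd (snd z)))"] ballI)
    show "W \<subseteq> topspace ?P" using openin_subset[OF W] .
    let ?D = "prod_topology ?I (subtopology ?P W)"
    have s1: "continuous_map ?D X (\<lambda>z. fst (snd z))" and s2: "continuous_map ?D Y (\<lambda>z. snd (snd z))"
      using continuous_map_compose[OF continuous_map_snd continuous_map_from_subtopology[OF continuous_map_fst]]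
        continuous_map_compose[OF continuous_map_snd continuous_map_from_subtopology[OF continuous_map_snd]]
      by (simp_all add: o_def)
    have "continuous_map ?D (prod_topology ?I X) (\<lambda>z. (fst z, fst (snd z)))"
      "continuous_map ?D (prod_topology ?I Y) (\<lambda>z. (fst z, snd (snd z)))"
      by (intro continuous_map_pairedI continuous_map_fst s1 s2)+
    from continuous_map_compose[OF this(1) H] continuous_map_compose[OF this(2) K]
    show "continuous_map ?D ?P (\<lambda>z. (H (fst z, fst (snd z)), K (fst z, snd (snd z))))"
      by (intro continuous_map_pairedI) (simp_all add: o_def)
    fix z assume z: "z \<in> W"
    then have zt: "fst z \<in> topspace X" "snd z \<in> topspace Y" using sub by (auto simp: W_def)
    show "(H (fst (0, z), fst (snd (0, z))), K (fst (0, z), snd (snd (0, z)))) = z"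
      using H0 K0 zt by simp
    have integral: "form_integral \<omega> (\<lambda>\<tau>. (H (\<tau> * t, fst z), K (\<tau> * t, snd z))) =
        form_integral \<omega>\<^sub>X (\<lambda>\<tau>. H (\<tau> * t, fst z)) + form_integral \<omega>\<^sub>Y (\<lambda>\<tau>. K (\<tau> * t, snd z))"
      if t: "t \<in> {0..1}" for t
    proof -
      have r: "continuous_on {0..1} (\<lambda>\<tau>. \<tau> * t)" "(\<lambda>\<tau>. \<tau> * t) ` {0..1} \<subseteq> {0..1}"
        using t by (auto intro!: continuous_intros mult_le_one)
      have "pathin X (\<lambda>\<tau>. H (\<tau> * t, fst z))" "pathin Y (\<lambda>\<tau>. K (\<tau> * t, snd z))"
        using pathin_reparametrize[OF pathin_ray[OF H zt(1)] r] pathin_reparametrize[OF pathin_ray[OF K zt(2)] r] .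
      then have "pathin ?P (\<lambda>\<tau>. (H (\<tau> * t, fst z), K (\<tau> * t, snd z)))"
        unfolding pathin_def by (intro continuous_map_pairedI)
      from int[OF this] show ?thesis by simp
    qed
    show "form_integral \<omega> (\<lambda>\<tau>. (H (fst (\<tau>, z), fst (snd (\<tau>, z))), K (fst (\<tau>, z), snd (snd (\<tau>, z))))) < - N"
    proof -
      have bounds: "form_integral \<omega>\<^sub>X (\<lambda>\<tau>. H (\<tau>, fst z)) \<le> C" "form_integral \<omega>\<^sub>Y (\<lambda>\<tau>. K (\<tau>, snd z)) \<le> D"
        using HC[OF zt(1), of 1] KC[OF zt(2), of 1] by simp_all
      consider "fst z \<in> F'" | "snd z \<in> G'" using z by (auto simp: W_def)
      then have "form_integral \<omega>\<^sub>X (\<lambda>\<tau>. H (\<tau>, fst z)) + form_integral \<omega>\<^sub>Y (\<lambda>\<tau>. K (\<tau>, snd z)) < - N"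
      proof cases
        case 1
        from HN[OF this] bounds show ?thesis by linarith
      next
        case 2
        from KN[OF this] bounds show ?thesis by linarith
      qed
      then show ?thesis using integral[of 1] by simp
    qed
    show "form_integral \<omega> (\<lambda>\<tau>. (H (fst (\<tau> * t, z), fst (snd (\<tau> * t, z))), K (fst (\<tau> * t, z), snd (snd (\<tau> * t, z))))) \<le> C + D"
      if t: "t \<in> {0..1}" for t
      using integral[OF t] HC[OF zt(1) t] KC[OF zt(2) t] by simp
  qed
  have "closedin X (topspace X - F')" using F'(1) by blast
  moreover have "topspace X - F' \<subseteq> (\<Union>i\<in>{1..k}. A i)" using F'(2) by blast
  ultimately obtain a :: "nat \<Rightarrow> 'a \<Rightarrow> real" where
    a: "\<forall>i\<in>{1..k}. continuous_map X euclideanreal (a i) \<and>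
             (\<forall>x\<in>topspace X. 0 \<le> a i x \<and> (0 < a i x \<longrightarrow> x \<in> A i))"
    and acov: "\<forall>x\<in>topspace X - F'. \<exists>i\<in>{1..k}. 0 < a i x"
    using shrinking_functions[OF X(1), of "{1..k}" A "topspace X - F'"] A by auto
  have "closedin Y (topspace Y - G')" using G'(1) by blast
  moreover have "topspace Y - G' \<subseteq> (\<Union>j\<in>{1..l}. B j)" using G'(2) by blast
  ultimately obtain b :: "nat \<Rightarrow> 'b \<Rightarrow> real" where
    b: "\<forall>j\<in>{1..l}. continuous_map Y euclideanreal (b j) \<and>
             (\<forall>y\<in>topspace Y. 0 \<le> b j y \<and> (0 < b j y \<longrightarrow> y \<in> B j))"
    and bcov: "\<forall>y\<in>topspace Y - G'. \<exists>j\<in>{1..l}. 0 < b j y"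
    using shrinking_functions[OF Y(1), of "{1..l}" B "topspace Y - G'"] B by auto
  define \<alpha> where "\<alpha> i x = (\<Sum>m\<in>{1..i}. a m x)" for i x
  define \<beta> where "\<beta> j y = (\<Sum>m\<in>{1..j}. b m y)" for j y
  have \<alpha>c: "continuous_map ?P euclideanreal (\<lambda>z. \<alpha> i (fst z))" if "i \<le> k" for i
    unfolding \<alpha>_def using a that continuous_map_compose[OF continuous_map_fst, of X euclideanreal _ Y]
    by (intro continuous_map_sum) (auto simp: o_def)
  have \<beta>c: "continuous_map ?P euclideanreal (\<lambda>z. \<beta> j (snd z))" if "j \<le> l" for j
    unfolding \<beta>_def using b that continuous_map_compose[OF continuous_map_snd, of Y euclideanreal _ X]
    by (intro continuous_map_sum) (auto simp: o_def)
  have \<alpha>mono: "\<alpha> i x \<le> \<alpha> i' x" if "i \<le> i'" "i' \<le> k" "x \<in> topspace X" for i i' x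
    unfolding \<alpha>_def using a that by (intro sum_mono2) auto
  have \<beta>mono: "\<beta> j y \<le> \<beta> j' y" if "j \<le> j'" "j' \<le> l" "y \<in> topspace Y" for j j' y
    unfolding \<beta>_def using b that by (intro sum_mono2) auto
  define J where "J s = {i \<in> {1..k}. i \<le> s \<and> s + 1 - i \<le> l}" for s
  \<comment> \<open>The open thickening of the stratum \<open>(i, s + 1 - i)\<close>. Positivity of the two functions puts it into
    a product of null-homotopic sets, the two comparisons separate it from the other strata in \<open>J s\<close>.\<close>
  define E where "E s i = {z \<in> topspace ?P. 0 < a i (fst z)} \<inter> {z \<in> topspace ?P. 0 < b (s + 1 - i) (snd z)} \<inter>
      ({z \<in> topspace ?P. \<beta> (s - i) (snd z) < \<alpha> i (fst z)} \<inter>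
       {z \<in> topspace ?P. \<alpha> (i - 1) (fst z) < \<beta> (s + 1 - i) (snd z)})" for s i
  define Q where "Q s = (\<Union>i\<in>J s. E s i)" for s
  have JD: "i \<in> {1..k}" "s + 1 - i \<in> {1..l}" "s - i \<le> l" "i \<le> s" "i \<le> k" "i - 1 \<le> k" "s + 1 - i \<le> l"
    if "i \<in> J s" for i s
    using that unfolding J_def by auto
  have Eop: "openin ?P (E s i)" if i: "i \<in> J s" for s i
  proof -
    have "continuous_map ?P euclideanreal (\<lambda>z. a i (fst z))"
      using a JD(1)[OF i] continuous_map_compose[OF continuous_map_fst, of X euclideanreal "a i" Y]
      by (simp add: o_def)
    moreover have "continuous_map ?P euclideanreal (\<lambda>z. b (s + 1 - i) (snd z))"
      using b JD(2)[OF i] continuous_map_compose[OF continuous_map_snd, of Y euclideanreal "b (s + 1 - i)" X]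
      by (simp add: o_def)
    ultimately show ?thesis
      unfolding E_def
      by (intro openin_Int openin_less \<alpha>c \<beta>c JD[OF i]) auto
  qed
  have Esub: "E s i \<subseteq> A i \<times> B (s + 1 - i)" if i: "i \<in> J s" for s i
  proof
    fix z assume "z \<in> E s i"
    then have "fst z \<in> topspace X" "snd z \<in> topspace Y" "0 < a i (fst z)" "0 < b (s + 1 - i) (snd z)"
      unfolding E_def by auto
    then have "fst z \<in> A i" "snd z \<in> B (s + 1 - i)"
      using bspec[OF a JD(1)[OF i]] bspec[OF b JD(2)[OF i]] by blast+
    then show "z \<in> A i \<times> B (s + 1 - i)" by (simp add: mem_Times_iff)
  qed
  have Enull: "null_homotopic_in ?P (E s i)" if i: "i \<in> J s" for s i
    using null_homotopic_in_mono[OF null_homotopic_in_Times Esub[OF i]] A[OF JD(1)[OF i]] B[OF JD(2)[OF i]]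
    by blast
  have Elt: "E s i \<inter> E s i' = {}" if i: "i \<in> J s" "i' \<in> J s" "i < i'" for s i i'
  proof (rule ccontr)
    assume "E s i \<inter> E s i' \<noteq> {}"
    then obtain z where z: "z \<in> topspace ?P" "\<beta> (s - i) (snd z) < \<alpha> i (fst z)"
      "\<alpha> (i' - 1) (fst z) < \<beta> (s + 1 - i') (snd z)"
      unfolding E_def by blast
    have "\<alpha> i (fst z) \<le> \<alpha> (i' - 1) (fst z)"
      using z(1) i JD(6)[OF i(2)] by (intro \<alpha>mono) auto
    moreover have "\<beta> (s + 1 - i') (snd z) \<le> \<beta> (s - i) (snd z)"
      using z(1) i JD(3)[OF i(1)] JD(4)[OF i(2)] by (intro \<beta>mono) auto
    ultimately show False using z(2,3) by linarith
  qed
  have Qop: "openin ?P (Q s)" for s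
    unfolding Q_def using Eop by (intro openin_Union) auto
  have Qnull: "null_homotopic_in ?P (Q s)" for s
  proof (cases "J s = {}")
    case True
    then have "subtopology ?P (Q s) = trivial_topology"
      by (simp add: Q_def null_topspace_iff_trivial)
    then show ?thesis
      unfolding null_homotopic_in_def
      by (intro exI[of _ undefined] homotopic_with_equal) auto
  next
    case False
    then obtain i where "i \<in> J s" by blast
    then have "k > 0" "l > 0" using JD[of i s] by auto
    then show ?thesis
      unfolding Q_def
    proof (intro null_homotopic_in_disjoint_Union pc Eop Enull)
      show "E s i \<inter> E s j = {}" if "i \<in> J s" "j \<in> J s" "i \<noteq> j" for i j
        using Elt[of i s j] Elt[of j s i] that by (metis inf_commute linorder_neqE_nat)
    qed
  qed
  have cover: "\<exists>s\<in>{1..k + l - 1}. z \<in> Q s" if z: "z \<in> topspace ?P" "z \<notin> W" for z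
  proof -
    have zt: "fst z \<in> topspace X" "snd z \<in> topspace Y" using z(1) by auto
    have "z \<notin> F' \<times> topspace Y" "z \<notin> topspace X \<times> G'" using z(2) by (simp_all add: W_def)
    then have "fst z \<notin> F'" "snd z \<notin> G'" using zt by (simp_all add: mem_Times_iff)
    then have exX: "\<exists>i. i \<in> {1..k} \<and> 0 < a i (fst z)" and exY: "\<exists>j. j \<in> {1..l} \<and> 0 < b j (snd z)"
      using acov bcov zt by blast+
    define i where "i = (LEAST i. i \<in> {1..k} \<and> 0 < a i (fst z))"
    define j where "j = (LEAST j. j \<in> {1..l} \<and> 0 < b j (snd z))"
    have i: "i \<in> {1..k}" "0 < a i (fst z)" using LeastI_ex[OF exX] unfolding i_def by auto
    have j: "j \<in> {1..l}" "0 < b j (snd z)" using LeastI_ex[OF exY] unfolding j_def by auto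
    have "a m (fst z) = 0" if m: "m \<in> {1..i - 1}" for m
    proof -
      have "m < i" "m \<in> {1..k}" using m i by auto
      then have "\<not> 0 < a m (fst z)" using not_less_Least[of m "\<lambda>i. i \<in> {1..k} \<and> 0 < a i (fst z)"]
        unfolding i_def by blast
      moreover have "0 \<le> a m (fst z)" using a \<open>m \<in> {1..k}\<close> zt(1) by blast
      ultimately show ?thesis by simp
    qed
    then have a0: "\<alpha> (i - 1) (fst z) = 0" unfolding \<alpha>_def by simp
    have "b m (snd z) = 0" if m: "m \<in> {1..j - 1}" for m
    proof -
      have "m < j" "m \<in> {1..l}" using m j by auto
      then have "\<not> 0 < b m (snd z)" using not_less_Least[of m "\<lambda>j. j \<in> {1..l} \<and> 0 < b j (snd z)"]
        unfolding j_def by blast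
      moreover have "0 \<le> b m (snd z)" using b \<open>m \<in> {1..l}\<close> zt(2) by blast
      ultimately show ?thesis by simp
    qed
    then have b0: "\<beta> (j - 1) (snd z) = 0" unfolding \<beta>_def by simp
    have "\<alpha> i (fst z) = a i (fst z) + \<alpha> (i - 1) (fst z)" using i(1) unfolding \<alpha>_def by (cases i) simp_all
    then have a1: "0 < \<alpha> i (fst z)" using a0 i(2) by simp
    have "\<beta> j (snd z) = b j (snd z) + \<beta> (j - 1) (snd z)" using j(1) unfolding \<beta>_def by (cases j) simp_all
    then have b1: "0 < \<beta> j (snd z)" using b0 j(2) by simp
    define s where "s = i + j - 1"
    have s: "s + 1 - i = j" "s - i = j - 1" "i \<le> s" "s \<in> {1..k + l - 1}"
      using i(1) j(1) by (auto simp: s_def)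
    have "i \<in> J s" using i(1) j(1) s unfolding J_def by simp
    moreover have "z \<in> E s i"
      unfolding E_def s(1,2) using z(1) i(2) j(2) a0 b0 a1 b1 by simp
    ultimately have "z \<in> Q s" unfolding Q_def by blast
    with s(4) show ?thesis by blast
  qed
  have "topspace ?P = W \<union> (\<Union>s\<in>{1..k + l - 1}. Q s)"
    using openin_subset[OF W] openin_subset[OF Qop] cover by blast
  with W mov Qop Qnull show ?thesis by blast
qed

lemma ccat_form_le:
  assumes "C > 0"
    and "\<And>N. N > 0 \<Longrightarrow> \<exists>F (G :: nat \<Rightarrow> 'a set). openin X F \<and> movable X \<omega> N C F \<and>
       (\<forall>j\<in>{1..k}. openin X (G j) \<and> null_homotopic_in X (G j)) \<and>
       topspace X = F \<union> (\<Union>j\<in>{1..k}. G j)"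
  shows "ccat_form X \<omega> \<le> enat k"
  unfolding ccat_form_def by (rule Inf_lower) (use assms in blast)

lemma Inf_enat_eq_enatD:
  assumes "Inf {enat k | k. Q k} = enat k"
  shows "Q k"
proof -
  have "{enat k | k. Q k} \<noteq> {}"
  proof
    assume "{enat k | k. Q k} = {}"
    then have "Inf {enat k | k. Q k} = \<infinity>" by (simp only: Inf_enat_def if_True simp_thms)
    with assms show False by simp
  qed
  then obtain y where y: "y \<in> {enat k | k. Q k}" by blast
  then have "Inf {enat k | k. Q k} = (LEAST x. x \<in> {enat k | k. Q k})"
    unfolding Inf_enat_def by auto
  moreover have "(LEAST x. x \<in> {enat k | k. Q k}) \<in> {enat k | k. Q k}"
    using y by (rule LeastI)
  ultimately have "enat k \<in> {enat k | k. Q k}" using assms by simp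
  then show ?thesis by simp
qed

lemma ccat_form_eq_enatE:
  assumes "ccat_form X \<omega> = enat k"
  obtains C where "C > 0"
    and "\<And>N. N > 0 \<Longrightarrow> \<exists>F (G :: nat \<Rightarrow> 'a set). openin X F \<and> movable X \<omega> N C F \<and>
       (\<forall>j\<in>{1..k}. openin X (G j) \<and> null_homotopic_in X (G j)) \<and>
       topspace X = F \<union> (\<Union>j\<in>{1..k}. G j)"
proof -
  from Inf_enat_eq_enatD[OF assms[unfolded ccat_form_def]] that show thesis by blast
qed

theorem theorem9:
  fixes X :: "'a topology" and Y :: "'b topology"
    and \<xi>\<^sub>X :: "'a cochain set" and \<xi>\<^sub>Y :: "'b cochain set"
    and \<xi> :: "('a \<times> 'b) cochain set"
  assumes "finite_cell_complex X" and "finite_cell_complex Y"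
    and "\<xi>\<^sub>X \<in> cohomology 1 X" and "\<xi>\<^sub>Y \<in> cohomology 1 Y"
    and "ccat X \<xi>\<^sub>X > 0 \<or> ccat Y \<xi>\<^sub>Y > 0"
    and "ccat X \<xi>\<^sub>X > 0 \<and> ccat Y \<xi>\<^sub>Y > 0 \<longrightarrow> connected_space X \<and> connected_space Y"
    and "\<xi> = cohomology_add 1 (prod_topology X Y)
               (cross_product 1 0 X Y \<xi>\<^sub>X (cohomology_one Y))
               (cross_product 0 1 X Y (cohomology_one X) \<xi>\<^sub>Y)"
  shows "ccat (prod_topology X Y) \<xi> \<le> ccat X \<xi>\<^sub>X + ccat Y \<xi>\<^sub>Y - 1"
proof (cases "ccat X \<xi>\<^sub>X = \<infinity> \<or> ccat Y \<xi>\<^sub>Y = \<infinity>")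
  case True
  then have "ccat X \<xi>\<^sub>X + ccat Y \<xi>\<^sub>Y - 1 = \<infinity>"
    by (auto simp: one_enat_def)
  then show ?thesis by simp
next
  case False
  let ?P = "prod_topology X Y"
  obtain k l where k: "ccat X \<xi>\<^sub>X = enat k" and l: "ccat Y \<xi>\<^sub>Y = enat l"
    using False by auto
  define \<omega>\<^sub>X where "\<omega>\<^sub>X = (SOME \<omega>. represents X \<omega> \<xi>\<^sub>X)"
  define \<omega>\<^sub>Y where "\<omega>\<^sub>Y = (SOME \<omega>. represents Y \<omega> \<xi>\<^sub>Y)"
  have "\<exists>\<omega>. represents X \<omega> \<xi>\<^sub>X" "\<exists>\<omega>. represents Y \<omega> \<xi>\<^sub>Y"
    using k l unfolding ccat_def by (auto split: if_splits)
  then have repX: "represents X \<omega>\<^sub>X \<xi>\<^sub>X" and repY: "represents Y \<omega>\<^sub>Y \<xi>\<^sub>Y"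
    and kX: "ccat_form X \<omega>\<^sub>X = enat k" and lY: "ccat_form Y \<omega>\<^sub>Y = enat l"
    using k l unfolding \<omega>\<^sub>X_def \<omega>\<^sub>Y_def ccat_def by (auto intro: someI_ex)
  then have \<omega>X: "\<omega>\<^sub>X \<in> closed_1_forms X" and \<omega>Y: "\<omega>\<^sub>Y \<in> closed_1_forms Y"
    unfolding represents_def by blast+
  obtain \<omega>\<^sub>P where \<omega>P: "\<omega>\<^sub>P \<in> closed_1_forms ?P"
    and int: "\<And>\<gamma>. pathin ?P \<gamma> \<Longrightarrow> form_integral \<omega>\<^sub>P \<gamma> =
           form_integral \<omega>\<^sub>X (\<lambda>t. fst (\<gamma> t)) + form_integral \<omega>\<^sub>Y (\<lambda>t. snd (\<gamma> t))"
    using obtain_product_form[OF \<omega>X \<omega>Y] by blast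
  have repP: "represents ?P \<omega>\<^sub>P \<xi>"
    unfolding assms(7) by (rule represents_cross_sum[OF repX repY \<omega>P int])
  define \<omega> where "\<omega> = (SOME \<omega>. represents ?P \<omega> \<xi>)"
  have rep: "represents ?P \<omega> \<xi>" unfolding \<omega>_def using repP by (rule someI)
  have ccatP: "ccat ?P \<xi> = ccat_form ?P \<omega>"
    using repP unfolding ccat_def \<omega>_def by auto
  obtain m :: nat and K :: "nat \<Rightarrow> (nat \<Rightarrow> real) topology" and H where X: "cone_cover {..<m} K H X"
    using finite_cell_complex_cone_cover[OF assms(1)] by blast
  obtain n :: nat and L :: "nat \<Rightarrow> (nat \<Rightarrow> real) topology" and M where Y: "cone_cover {..<n} L M Y"
    using finite_cell_complex_cone_cover[OF assms(2)] by blast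
  obtain \<phi> where \<phi>: "\<phi> \<in> \<xi>"
    using rep cohomology_representative unfolding represents_def by metis
  have per: "form_integral \<omega>\<^sub>P \<gamma> = form_integral \<omega> \<gamma>" if "pathin ?P \<gamma>" "\<gamma> 0 = \<gamma> 1" for \<gamma>
    using rep repP \<phi> that unfolding represents_def by metis
  have "\<omega> \<in> closed_1_forms ?P" using rep unfolding represents_def by blast
  from same_periods_imp_integrals_boundedly_close[OF cone_cover_prod[OF X Y] \<omega>P this per]
  obtain B where B: "B \<ge> 0"
    and close: "\<And>\<gamma>. pathin ?P \<gamma> \<Longrightarrow> \<bar>form_integral \<omega>\<^sub>P \<gamma> - form_integral \<omega> \<gamma>\<bar> \<le> B"
    by blast
  have HX: "Hausdorff_space X" and HY: "Hausdorff_space Y"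
    using conjunct1[OF assms(1)[unfolded finite_cell_complex_def]]
      conjunct1[OF assms(2)[unfolded finite_cell_complex_def]] .
  have normal: "normal_space X" "normal_space Y"
    using compact_Hausdorff_or_regular_imp_normal_space cone_cover_imp_compact_space X Y HX HY by blast+
  have pc: "path_connected_space ?P" if "k > 0" "l > 0"
  proof -
    have "connected_space X" "connected_space Y"
      using assms(6) that k l by (auto simp: zero_enat_def)
    then show ?thesis
      using cone_cover_path_connected[OF X HX] cone_cover_path_connected[OF Y HY]
      by (simp add: path_connected_space_prod_topology)
  qed
  obtain C where C: "C > 0" and covX: "\<And>N. N > 0 \<Longrightarrow> \<exists>F (G :: nat \<Rightarrow> 'a set).
       openin X F \<and> movable X \<omega>\<^sub>X N C F \<and>
       (\<forall>j\<in>{1..k}. openin X (G j) \<and> null_homotopic_in X (G j)) \<and>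
       topspace X = F \<union> (\<Union>j\<in>{1..k}. G j)"
    using ccat_form_eq_enatE[OF kX] by blast
  obtain D where D: "D > 0" and covY: "\<And>N. N > 0 \<Longrightarrow> \<exists>F (G :: nat \<Rightarrow> 'b set).
       openin Y F \<and> movable Y \<omega>\<^sub>Y N D F \<and>
       (\<forall>j\<in>{1..l}. openin Y (G j) \<and> null_homotopic_in Y (G j)) \<and>
       topspace Y = F \<union> (\<Union>j\<in>{1..l}. G j)"
    using ccat_form_eq_enatE[OF lY] by blast
  have "ccat_form ?P \<omega> \<le> enat (k + l - 1)"
  proof (rule ccat_form_le)
    show "C + D + B > 0" using B C D by simp
    fix N :: real assume N: "N > 0"
    \<comment> \<open>The margin \<open>B\<close> pays for the change of form on the product, \<open>D\<close> and \<open>C\<close> for the other factor.\<close>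
    obtain F A where F: "openin X F" "movable X \<omega>\<^sub>X (N + B + D) C F"
      and A: "\<forall>j\<in>{1..k}. openin X (A j) \<and> null_homotopic_in X (A j)"
      and cX: "topspace X = F \<union> (\<Union>j\<in>{1..k}. A j)"
      using covX[of "N + B + D"] N B D by auto
    obtain G E where G: "openin Y G" "movable Y \<omega>\<^sub>Y (N + B + C) D G"
      and E: "\<forall>j\<in>{1..l}. openin Y (E j) \<and> null_homotopic_in Y (E j)"
      and cY: "topspace Y = G \<union> (\<Union>j\<in>{1..l}. E j)"
      using covY[of "N + B + C"] N B C by auto
    obtain W Q where W: "openin ?P W" "movable ?P \<omega>\<^sub>P (N + B) (C + D) W"
      and Q: "\<forall>s\<in>{1..k + l - 1}. openin ?P (Q s) \<and> null_homotopic_in ?P (Q s)"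
      and cover: "topspace ?P = W \<union> (\<Union>s\<in>{1..k + l - 1}. Q s)"
      using product_cover[OF normal(1) \<omega>X normal(2) \<omega>Y int less_imp_le[OF C] less_imp_le[OF D]
          F bspec[OF A] cX G bspec[OF E] cY pc] by blast
    have "movable ?P \<omega> N (C + D + B) W"
      using movable_change_form[OF W(2) close] by simp
    with W(1) Q cover show "\<exists>F G. openin ?P F \<and> movable ?P \<omega> N (C + D + B) F \<and>
       (\<forall>j\<in>{1..k + l - 1}. openin ?P (G j) \<and> null_homotopic_in ?P (G j)) \<and>
       topspace ?P = F \<union> (\<Union>j\<in>{1..k + l - 1}. G j)" by blast
  qed
  then show ?thesis by (simp add: ccatP k l one_enat_def)
qed

end
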